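(* Let $\{u^n\}_{n=0}^N$ be the discrete DLR solution produced by the scheme described in the context with the explicit evaluation $\mathcal L(u^n,u^{n+1})=\mathcal L(u^n)$ and $f^{n,n+1}=f(t_n)$. Then: 1. For every $\kappa>0$ and $\triangle t,h$ satisfying $\dfrac{\triangle t}{h^{2p}}\le\dfrac{\kappa\,C_{\mathcal L}}{C_I^2C_{\mathcal B}^2}$, $$\|u^N\|_{H,\hat\rho}^2+\triangle t\,C_{\mathcal L}(1-\kappa)\sum_{n=0}^{N-1}\|u^{n+1}\|_{V,\hat\rho}^2\le\|u^0\|_{H,\hat\rho}^2+\frac{\triangle t\,C_P^2}{C_{\mathcal L}}\sum_{n=0}^{N-1}\|f(t_n)\|_{H,\hat\rho}^2.$$ 2. If $\mathcal L$ is symmetric, then for every $0<\kappa<2$ and $\triangle t,h$ satisfying $\dfrac{\triangle t}{h^{2p}}\le\dfrac{2-\kappa}{C_I^2C_{\mathcal B}}$, $$\|u^N\|_{\mathcal L,\hat\rho}^2\le\|u^0\|_{\mathcal L,\hat\rho}^2+\frac{\triangle t}{\kappa}\sum_{n=0}^{N-1}\|f(t_n)\|_{H,\hat\rho}^2.$$ For $f=0$ and $n=0,\dots,N-1$: 3. $\|u^{n+1}\|_{H,\hat\rho}\le\|u^n\|_{H,\hat\rho}$ under the weakened condition $\dfrac{\triangle t}{h^{2p}}\le\dfrac{2C_{\mathcal L}}{C_I^2C_{\mathcal B}^2}$. 4. If $\mathcal L$ is symmetric, $\|u^{n+1}\|_{\mathcal L,\hat\rho}\le\|u^n\|_{\mathcal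 L,\hat\rho}$ and $\|u^{n+1}\|_{H,\hat\rho}\le\|u^n\|_{H,\hat\rho}$ under the weakened condition $\dfrac{\triangle t}{h^{2p}}\le\dfrac{2}{C_I^2C_{\mathcal B}}$.
   Context: Setting. $V,H$ are separable real Hilbert spaces forming a Gelfand triple $V\subset H\subset V'$, with $V$ dense in $H$ and $\|v\|_H\le C_P\|v\|_V$ for $v\in V$, $C_P>0$; $(\cdot,\cdot)_{V'V}$ is the duality pairing, extending $\langle\cdot,\cdot\rangle_H$. $\hat\Gamma=\{\omega_1,\dots,\omega_{\hat N}\}$ is a finite set of points with weights $\lambda_k>0$, $\sum_k\lambda_k=1$, $\hat\rho=\sum_k\lambda_k\delta_{\omega_k}$. $L^2_{\hat\rho}$ is the space of real functions on $\hat\Gamma$ with $\langle v,w\rangle_{L^2_{\hat\rho}}=\sum_k\lambda_kv(\omega_k)w(\omega_k)$; $\mathbb E_{\hat\rho}[v]=\sum_k\lambda_kv(\omega_k)$ (also for vector-valued $v$); $v^*:=v-\mathbb E_{\hat\rho}[v]$. For $X\in\{V,H\}$ and functions $\hat\Gamma\to X$: $\langle v,w\rangle_{X,\hat\rho}=\sum_k\lambda_k\langle v(\omega_k),w(\omega_k)\rangle_X$ with norm $\|\cdot\|_{X,\hat\rho}$. $L(\omega):V\to V'$ is a linear operator for each $\omega$, with constants $C_{\mathcal L},C_{\mathcal B}>0$ such that $(L(\omega)v,v)_{V'V}\ge C_{\mathcal L}\|v\|_V^2$ and $(L(\omega)v,w)_{V'V}\le C_{\mathcal B}\|v\|_V\|w\|_V$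 for all $\omega$ and $v,w\in V$; $\mathcal L(u)(\omega)=L(\omega)u(\omega)$ and $\langle v,w\rangle_{\mathcal L,\hat\rho}=\sum_k\lambda_k(L(\omega_k)v(\omega_k),w(\omega_k))_{V'V}$. "$\mathcal L$ symmetric" means each form $(L(\omega)v,w)_{V'V}$ is symmetric in $v,w\in V$; then $\|v\|_{\mathcal L,\hat\rho}^2=\langle v,v\rangle_{\mathcal L,\hat\rho}$. $V_h\subset V$ is a finite-dimensional subspace (parameter $h>0$), $\dim V_h>R$, $R<\hat N$; $V_h\otimes L^2_{\hat\rho}$ is identified with functions $\hat\Gamma\to V_h$, and the inverse inequality $\|v\|_{V,\hat\rho}\le\frac{C_I}{h^p}\|v\|_{H,\hat\rho}$ holds for all $v\in V_h\otimes L^2_{\hat\rho}$, for some $p\in\mathbb N$, $C_I>0$. $\triangle t=T/N$, $t_n=n\triangle t$. The forcing values $f(t_n):\hat\Gamma\to H$ are given. Scheme (one step, from $u^n$ to $u^{n+1}$). Given $u^n=\bar u^n+\sum_{j=1}^RU^n_jY^n_j$ with $\bar u^n,U^n_j\in V_h$, $Y^n_j\in L^2_{\hat\rho}$, $\langle Y^n_i,Y^n_j\rangle_{L^2_{\hat\rho}}=\delta_{ij}$, $\mathbb E_{\hat\rho}[Y^n_j]=0$; write $U=(U_1,\dots,U_R)$, $Y=(Y_1,\dots,Y_R)$ and $G:=\mathcal L(u^n,u^{n+1})-f^{n,n+1}$. 1. $\bar u^{n+1}\in V_h$: $\langle\frac{\bar u^{n+1}-\bar u^n}{\triangle t},v_h\rangle_H+(\mathbb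 E_{\hat\rho}[G],v_h)_{V'V}=0$ for all $v_h\in V_h$. 2. $\tilde U^{n+1}_j\in V_h$: $\langle\frac{\tilde U^{n+1}_j-U^n_j}{\triangle t},v_h\rangle_H+(\mathbb E_{\hat\rho}[G\,Y^n_j],v_h)_{V'V}=0$ for all $v_h\in V_h$, $j=1,\dots,R$. 3. $\tilde Y^{n+1}\in(L^2_{\hat\rho})^R$: $\frac{\tilde Y^{n+1}-Y^n}{\triangle t}\tilde M^{n+1}+\mathcal P^\perp_{\hat\rho,\mathcal Y^n}\big[(G^*,\tilde U^{n+1})_{V'V}\big]=0$, where $\tilde M^{n+1}_{ij}=\langle\tilde U^{n+1}_i,\tilde U^{n+1}_j\rangle_H$, $(G^*,\tilde U^{n+1})_{V'V}$ is the row $((G^*,\tilde U^{n+1}_j)_{V'V})_j$ of elements of $L^2_{\hat\rho}$, and $\mathcal P^\perp_{\hat\rho,\mathcal Y^n}$ is the $L^2_{\hat\rho}$-orthogonal projection onto the orthogonal complement of $\mathcal Y^n=\mathrm{span}\{Y^n_1,\dots,Y^n_R\}$. If $\tilde M^{n+1}$ is singular, $\tilde Y^{n+1}$ is a solution of this equation minimizing $\|\tilde Y^{n+1}-Y^n\|_{L^2_{\hat\rho}}$ (norm on $(L^2_{\hat\rho})^R$). 4. Reorthonormalize: $(U^{n+1},Y^{n+1})$ with $\sum_jY^{n+1}_jU^{n+1}_j=\sum_j\tilde Y^{n+1}_j\tilde U^{n+1}_j$, $\langle Y^{n+1}_i,Y^{n+1}_j\rangle_{L^2_{\hat\rho}}=\delta_{ij}$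 (and zero-mean $Y^{n+1}_j$). 5. $u^{n+1}=\bar u^{n+1}+\sum_jU^{n+1}_jY^{n+1}_j$. Throughout, it is assumed that a discrete DLR solution exists. *)

theory Defs
  imports "HOL-Analysis.Analysis"
begin

text \<open>
  Conventions. The sample set is a finite set \<open>\<Gamma>\<close> with weights \<open>lam\<close>; a random variable is a
  function on the ambient type \<open>'w\<close> of which only the values on \<open>\<Gamma>\<close> matter, so all identities
  between random variables are asserted pointwise on \<open>\<Gamma>\<close>.

  The Gelfand triple consists of types \<open>'v\<close>, \<open>'h\<close> and an injective bounded linear
  \<open>\<iota> :: 'v \<Rightarrow>\<^sub>L 'h\<close> playing the role of the inclusion of V in H. The dual V' is
  \<open>'v \<Rightarrow>\<^sub>L real\<close> and the duality pairing is application.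
\<close>

definition expect :: "'w set \<Rightarrow> ('w \<Rightarrow> real) \<Rightarrow> ('w \<Rightarrow> 'a::real_vector) \<Rightarrow> 'a" where
  "expect \<Gamma> lam v = (\<Sum>\<omega>\<in>\<Gamma>. lam \<omega> *\<^sub>R v \<omega>)"

definition centered :: "'w set \<Rightarrow> ('w \<Rightarrow> real) \<Rightarrow> ('w \<Rightarrow> 'a::real_vector) \<Rightarrow> 'w \<Rightarrow> 'a" where
  "centered \<Gamma> lam v = (\<lambda>\<omega>. v \<omega> - expect \<Gamma> lam v)"

text \<open>Used with \<open>'a\<close> equal to V, to H and to the reals (the latter being the weighted \<open>L\<^sup>2\<close>).\<close>

definition inner_rho ::
  "'w set \<Rightarrow> ('w \<Rightarrow> real) \<Rightarrow> ('w \<Rightarrow> 'a::real_inner) \<Rightarrow> ('w \<Rightarrow> 'a) \<Rightarrow> real" where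
  "inner_rho \<Gamma> lam v w = (\<Sum>\<omega>\<in>\<Gamma>. lam \<omega> * inner (v \<omega>) (w \<omega>))"

definition norm_rho :: "'w set \<Rightarrow> ('w \<Rightarrow> real) \<Rightarrow> ('w \<Rightarrow> 'a::real_inner) \<Rightarrow> real" where
  "norm_rho \<Gamma> lam v = sqrt (inner_rho \<Gamma> lam v v)"

definition inner_L ::
  "('w \<Rightarrow> 'v \<Rightarrow> ('v::real_inner \<Rightarrow>\<^sub>L real)) \<Rightarrow> 'w set \<Rightarrow> ('w \<Rightarrow> real) \<Rightarrow> ('w \<Rightarrow> 'v) \<Rightarrow> ('w \<Rightarrow> 'v) \<Rightarrow> real"
  where
  "inner_L L \<Gamma> lam v w = (\<Sum>\<omega>\<in>\<Gamma>. lam \<omega> * blinfun_apply (L \<omega> (v \<omega>)) (w \<omega>))"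

definition norm_L ::
  "('w \<Rightarrow> 'v \<Rightarrow> ('v::real_inner \<Rightarrow>\<^sub>L real)) \<Rightarrow> 'w set \<Rightarrow> ('w \<Rightarrow> real) \<Rightarrow> ('w \<Rightarrow> 'v) \<Rightarrow> real" where
  "norm_L L \<Gamma> lam v = sqrt (inner_L L \<Gamma> lam v v)"

text \<open>The inclusion of H in V', sending \<open>h\<close> to the functional \<open>v \<mapsto> inner h (\<iota> v)\<close>.\<close>

definition H_to_dual :: "('v::real_inner \<Rightarrow>\<^sub>L 'h::real_inner) \<Rightarrow> 'h \<Rightarrow> ('v \<Rightarrow>\<^sub>L real)" where
  "H_to_dual \<iota> h = blinfun_inner_right h o\<^sub>L \<iota>"

definition L2_span :: "'w set \<Rightarrow> nat \<Rightarrow> (nat \<Rightarrow> 'w \<Rightarrow> real) \<Rightarrow> ('w \<Rightarrow> real) set" where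
  "L2_span \<Gamma> R Y = {v. \<exists>c. \<forall>\<omega>\<in>\<Gamma>. v \<omega> = (\<Sum>j=1..R. c j * Y j \<omega>)}"

definition L2_orth_compl ::
  "'w set \<Rightarrow> ('w \<Rightarrow> real) \<Rightarrow> ('w \<Rightarrow> real) set \<Rightarrow> ('w \<Rightarrow> real) set" where
  "L2_orth_compl \<Gamma> lam S = {w. \<forall>s\<in>S. inner_rho \<Gamma> lam w s = 0}"

text \<open>Orthogonal projection onto a subspace \<open>S\<close>. As the weights are positive on \<open>\<Gamma>\<close>, its
  values on \<open>\<Gamma>\<close> are uniquely determined; those outside \<open>\<Gamma>\<close> are arbitrary.\<close>

definition L2_proj ::
  "'w set \<Rightarrow> ('w \<Rightarrow> real) \<Rightarrow> ('w \<Rightarrow> real) set \<Rightarrow> ('w \<Rightarrow> real) \<Rightarrow> 'w \<Rightarrow> real" where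
  "L2_proj \<Gamma> lam S v =
     (SOME w. w \<in> S \<and> (\<forall>s\<in>S. inner_rho \<Gamma> lam (\<lambda>\<omega>. v \<omega> - w \<omega>) s = 0))"

definition singular_mat :: "nat \<Rightarrow> (nat \<Rightarrow> nat \<Rightarrow> real) \<Rightarrow> bool" where
  "singular_mat R M \<longleftrightarrow>
     \<not> (\<exists>B. \<forall>i\<in>{1..R}. \<forall>j\<in>{1..R}. (\<Sum>k=1..R. M i k * B k j) = (if i = j then 1 else 0))"

definition mass_mat ::
  "('v::real_inner \<Rightarrow>\<^sub>L 'h::real_inner) \<Rightarrow> (nat \<Rightarrow> 'v) \<Rightarrow> nat \<Rightarrow> nat \<Rightarrow> real" where
  "mass_mat \<iota> U i j = inner (blinfun_apply \<iota> (U i)) (blinfun_apply \<iota> (U j))"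

definition dlr_factors ::
  "'w set \<Rightarrow> ('w \<Rightarrow> real) \<Rightarrow> 'v::real_inner set \<Rightarrow> nat
     \<Rightarrow> 'v \<Rightarrow> (nat \<Rightarrow> 'v) \<Rightarrow> (nat \<Rightarrow> 'w \<Rightarrow> real) \<Rightarrow> bool" where
  "dlr_factors \<Gamma> lam Vh R ub U Y \<longleftrightarrow>
     ub \<in> Vh \<and> (\<forall>j\<in>{1..R}. U j \<in> Vh) \<and>
     (\<forall>i\<in>{1..R}. \<forall>j\<in>{1..R}. inner_rho \<Gamma> lam (Y i) (Y j) = (if i = j then 1 else 0)) \<and>
     (\<forall>j\<in>{1..R}. expect \<Gamma> lam (Y j) = 0)"

definition dlr_fun ::
  "nat \<Rightarrow> 'v::real_inner \<Rightarrow> (nat \<Rightarrow> 'v) \<Rightarrow> (nat \<Rightarrow> 'w \<Rightarrow> real) \<Rightarrow> 'w \<Rightarrow> 'v" where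
  "dlr_fun R ub U Y = (\<lambda>\<omega>. ub + (\<Sum>j=1..R. Y j \<omega> *\<^sub>R U j))"

text \<open>The row-vector equation for the stochastic modes, one component per \<open>j\<close>.\<close>

definition stoch_eq ::
  "('v::real_inner \<Rightarrow>\<^sub>L 'h::real_inner) \<Rightarrow> 'w set \<Rightarrow> ('w \<Rightarrow> real) \<Rightarrow> nat \<Rightarrow> real
     \<Rightarrow> ('w \<Rightarrow> ('v \<Rightarrow>\<^sub>L real)) \<Rightarrow> (nat \<Rightarrow> 'w \<Rightarrow> real) \<Rightarrow> (nat \<Rightarrow> 'v) \<Rightarrow> (nat \<Rightarrow> 'w \<Rightarrow> real) \<Rightarrow> bool" where
  "stoch_eq \<iota> \<Gamma> lam R dt G Y Ut Yt \<longleftrightarrow>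
     (\<forall>j\<in>{1..R}. \<forall>\<omega>\<in>\<Gamma>.
        (\<Sum>i=1..R. (Yt i \<omega> - Y i \<omega>) / dt * mass_mat \<iota> Ut i j)
        + L2_proj \<Gamma> lam (L2_orth_compl \<Gamma> lam (L2_span \<Gamma> R Y))
            (\<lambda>\<theta>. blinfun_apply (centered \<Gamma> lam G \<theta>) (Ut j)) \<omega> = 0)"

definition stoch_dist ::
  "'w set \<Rightarrow> ('w \<Rightarrow> real) \<Rightarrow> nat \<Rightarrow> (nat \<Rightarrow> 'w \<Rightarrow> real) \<Rightarrow> (nat \<Rightarrow> 'w \<Rightarrow> real) \<Rightarrow> real" where
  "stoch_dist \<Gamma> lam R Z Y = sqrt (\<Sum>j=1..R. (norm_rho \<Gamma> lam (\<lambda>\<omega>. Z j \<omega> - Y j \<omega>))\<^sup>2)"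

text \<open>One step from \<open>(ub, U, Y)\<close> to \<open>(ub', U', Y')\<close>; \<open>G\<close> stands for the operator evaluation
  minus the forcing, with values in V', so that different evaluations give different schemes.\<close>

definition dlr_step ::
  "('v::real_inner \<Rightarrow>\<^sub>L 'h::real_inner) \<Rightarrow> 'w set \<Rightarrow> ('w \<Rightarrow> real) \<Rightarrow> 'v set \<Rightarrow> nat \<Rightarrow> real
     \<Rightarrow> ('w \<Rightarrow> ('v \<Rightarrow>\<^sub>L real))
     \<Rightarrow> 'v \<Rightarrow> (nat \<Rightarrow> 'v) \<Rightarrow> (nat \<Rightarrow> 'w \<Rightarrow> real)
     \<Rightarrow> 'v \<Rightarrow> (nat \<Rightarrow> 'v) \<Rightarrow> (nat \<Rightarrow> 'w \<Rightarrow> real) \<Rightarrow> bool" where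
  "dlr_step \<iota> \<Gamma> lam Vh R dt G ub U Y ub' U' Y' \<longleftrightarrow>
     ub' \<in> Vh \<and>
     (\<forall>v\<in>Vh. inner (blinfun_apply \<iota> ((ub' - ub) /\<^sub>R dt)) (blinfun_apply \<iota> v)
              + blinfun_apply (expect \<Gamma> lam G) v = 0) \<and>
     (\<exists>Ut Yt.
        (\<forall>j\<in>{1..R}. Ut j \<in> Vh \<and>
           (\<forall>v\<in>Vh. inner (blinfun_apply \<iota> ((Ut j - U j) /\<^sub>R dt)) (blinfun_apply \<iota> v)
                    + blinfun_apply (expect \<Gamma> lam (\<lambda>\<omega>. Y j \<omega> *\<^sub>R G \<omega>)) v = 0)) \<and>
        stoch_eq \<iota> \<Gamma> lam R dt G Y Ut Yt \<and>
        (singular_mat R (mass_mat \<iota> Ut) \<longrightarrow>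
           (\<forall>Z. stoch_eq \<iota> \<Gamma> lam R dt G Y Ut Z
                  \<longrightarrow> stoch_dist \<Gamma> lam R Yt Y \<le> stoch_dist \<Gamma> lam R Z Y)) \<and>
        (\<forall>\<omega>\<in>\<Gamma>. (\<Sum>j=1..R. Y' j \<omega> *\<^sub>R U' j) = (\<Sum>j=1..R. Yt j \<omega> *\<^sub>R Ut j)) \<and>
        dlr_factors \<Gamma> lam Vh R ub' U' Y')"

text \<open>\<open>u\<close> is a discrete DLR solution for the explicit evaluation: on the step from \<open>n\<close> to
  \<open>n + 1\<close> the operator acts on \<open>u n\<close> and the forcing is taken at time \<open>n * dt\<close>.\<close>

definition explicit_dlr_solution ::
  "('v::real_inner \<Rightarrow>\<^sub>L 'h::real_inner) \<Rightarrow> ('w \<Rightarrow> 'v \<Rightarrow> ('v \<Rightarrow>\<^sub>L real)) \<Rightarrow> (real \<Rightarrow> 'w \<Rightarrow> 'h)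
     \<Rightarrow> 'w set \<Rightarrow> ('w \<Rightarrow> real) \<Rightarrow> 'v set \<Rightarrow> nat \<Rightarrow> real \<Rightarrow> nat \<Rightarrow> (nat \<Rightarrow> 'w \<Rightarrow> 'v) \<Rightarrow> bool" where
  "explicit_dlr_solution \<iota> L f \<Gamma> lam Vh R dt N u \<longleftrightarrow>
     (\<exists>ub U Y.
        dlr_factors \<Gamma> lam Vh R (ub 0) (U 0) (Y 0) \<and>
        (\<forall>n\<le>N. \<forall>\<omega>\<in>\<Gamma>. u n \<omega> = dlr_fun R (ub n) (U n) (Y n) \<omega>) \<and>
        (\<forall>n<N. dlr_step \<iota> \<Gamma> lam Vh R dt
                 (\<lambda>\<omega>. L \<omega> (u n \<omega>) - H_to_dual \<iota> (f (real n * dt) \<omega>))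
                 (ub n) (U n) (Y n) (ub (Suc n)) (U (Suc n)) (Y (Suc n))))"

end

theory Submission
  imports Defs
begin

text \<open>
  Each step is a Galerkin step: the increment \<open>u' - u\<close> satisfies the weak form of the explicit
  Euler equation against every function in the tangent space spanned by the constant, \<open>Y\<close> and
  \<open>Ut\<close> directions, a space that contains both \<open>u\<close> and \<open>u'\<close>. Testing with \<open>u'\<close> gives the
  estimates in the H norm, testing with \<open>u' - u\<close> those in the energy norm; the inverse inequality
  absorbs the error of the explicit evaluation into \<open>\<parallel>u' - u\<parallel>\<^sub>H\<close>, which both identities control.
\<close>

text \<open>The increment is written in the frame of the old modes: coefficients
  \<open>ub' - ub\<close> along 1 and \<open>Ut j - U j\<close> along \<open>Y j\<close>, plus a
  remainder \<open>Z\<close> whose moments against 1 and every \<open>Y j\<close> vanish. In this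
  orthogonal splitting the mean equation, the mode equations and the stochastic equation each see
  only their own component of a test function, so they may simply be added. Pairing old
  \<open>Y\<close> with new \<open>Ut\<close> is what keeps both end values admissible:
  \<open>u\<close> has coefficients \<open>ub\<close>, \<open>U\<close> and no remainder, while
  \<open>u'\<close> has coefficients \<open>ub'\<close>, \<open>Ut\<close> and remainder
  \<open>Z\<close>.

  The role of \<kappa> is to divide a dissipation budget. In the H estimate coercivity supplies two
  units of \<open>C_L\<close>: \<kappa> of them pay for evaluating the operator at the old value,
  one pays for the forcing, and 1 - \<kappa> remain. In the energy estimate the budget is 2 / dt
  times the squared H norm of the increment: 2 - \<kappa> parts pay for the inverse inequality and
  \<kappa> parts for the forcing. Without forcing its share is released, which gives the weakened
  conditions as the endpoints \<kappa> = 2 and \<kappa> = 0.\<close>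

text \<open>Generalizes \<open>inner_L\<close> to an arbitrary V'-valued random variable, so that
  operator and forcing can be treated as one \<open>G\<close> throughout the analysis of a step and
  be separated only at the end.\<close>

definition dual_rho ::
  "'w set \<Rightarrow> ('w \<Rightarrow> real) \<Rightarrow> ('w \<Rightarrow> ('v::real_inner \<Rightarrow>\<^sub>L real)) \<Rightarrow> ('w \<Rightarrow> 'v) \<Rightarrow> real" where
  "dual_rho \<Gamma> lam G v = (\<Sum>\<omega>\<in>\<Gamma>. lam \<omega> * blinfun_apply (G \<omega>) (v \<omega>))"

lemma inner_L_eq_dual_rho: "inner_L L \<Gamma> lam v w = dual_rho \<Gamma> lam (\<lambda>\<omega>. L \<omega> (v \<omega>)) w"
  by (simp add: inner_L_def dual_rho_def)

lemma H_to_dual_apply [simp]: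
  "blinfun_apply (H_to_dual \<iota> x) v = inner x (blinfun_apply \<iota> v)"
  by (simp add: H_to_dual_def)

section \<open>Bilinear calculus of expectations and weighted pairings\<close>

lemma inner_rho_cong:
  assumes "\<And>\<omega>. \<omega> \<in> \<Gamma> \<Longrightarrow> v \<omega> = v' \<omega>" "\<And>\<omega>. \<omega> \<in> \<Gamma> \<Longrightarrow> w \<omega> = w' \<omega>"
  shows "inner_rho \<Gamma> lam v w = inner_rho \<Gamma> lam v' w'"
  unfolding inner_rho_def using assms by (intro sum.cong) auto

lemma inner_rho_commute: "inner_rho \<Gamma> lam v w = inner_rho \<Gamma> lam w v"
  by (simp add: inner_rho_def inner_commute)

lemma inner_rho_diff_left:
  "inner_rho \<Gamma> lam (\<lambda>\<omega>. v \<omega> - w \<omega>) z = inner_rho \<Gamma> lam v z - inner_rho \<Gamma> lam w z"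
  by (simp add: inner_rho_def inner_diff_left right_diff_distrib sum_subtractf)

lemma inner_rho_add_right:
  "inner_rho \<Gamma> lam z (\<lambda>\<omega>. v \<omega> + w \<omega>) = inner_rho \<Gamma> lam z v + inner_rho \<Gamma> lam z w"
  by (simp add: inner_rho_def inner_add_right distrib_left sum.distrib)

lemma inner_rho_diff_right:
  "inner_rho \<Gamma> lam z (\<lambda>\<omega>. v \<omega> - w \<omega>) = inner_rho \<Gamma> lam z v - inner_rho \<Gamma> lam z w"
  by (simp add: inner_rho_def inner_diff_right right_diff_distrib sum_subtractf)

lemma inner_rho_scaleR_right:
  "inner_rho \<Gamma> lam v (\<lambda>\<omega>. c *\<^sub>R w \<omega>) = c * inner_rho \<Gamma> lam v w"
  by (simp add: inner_rho_def sum_distrib_left mult_ac)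

lemma inner_rho_mult_right:
  "inner_rho \<Gamma> lam v (\<lambda>\<omega>. c * w \<omega>) = c * inner_rho \<Gamma> lam v w" for w :: "'w \<Rightarrow> real"
  using inner_rho_scaleR_right[of \<Gamma> lam v c w] by simp

lemma inner_rho_sum_right:
  "inner_rho \<Gamma> lam v (\<lambda>\<omega>. \<Sum>j\<in>J. w j \<omega>) = (\<Sum>j\<in>J. inner_rho \<Gamma> lam v (w j))"
  unfolding inner_rho_def inner_sum_right sum_distrib_left by (rule sum.swap)

lemma inner_rho_const_right:
  "inner_rho \<Gamma> lam v (\<lambda>\<omega>. a) = inner (expect \<Gamma> lam v) a"
  by (simp add: inner_rho_def expect_def inner_sum_left)

lemma inner_rho_scaleR_const_right:
  "inner_rho \<Gamma> lam v (\<lambda>\<omega>. y \<omega> *\<^sub>R a) = inner (expect \<Gamma> lam (\<lambda>\<omega>. y \<omega> *\<^sub>R v \<omega>)) a"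
  by (simp add: inner_rho_def expect_def inner_sum_left mult_ac)

lemma expect_add: "expect \<Gamma> lam (\<lambda>\<omega>. v \<omega> + w \<omega>) = expect \<Gamma> lam v + expect \<Gamma> lam w"
  by (simp add: expect_def scaleR_add_right sum.distrib)

lemma expect_sum: "expect \<Gamma> lam (\<lambda>\<omega>. \<Sum>j\<in>J. v j \<omega>) = (\<Sum>j\<in>J. expect \<Gamma> lam (v j))"
  unfolding expect_def scaleR_sum_right by (rule sum.swap)

lemma expect_scaleR_const:
  "expect \<Gamma> lam (\<lambda>\<omega>. y \<omega> *\<^sub>R a) = expect \<Gamma> lam y *\<^sub>R a"
  by (simp add: expect_def scaleR_sum_left)

lemma expect_blinfun_apply:
  "blinfun_apply B (expect \<Gamma> lam v) = expect \<Gamma> lam (\<lambda>\<omega>. blinfun_apply B (v \<omega>))"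
  by (simp add: expect_def blinfun.sum_right blinfun.scaleR_right)

lemma blinfun_apply_expect:
  "blinfun_apply (expect \<Gamma> lam G) v = expect \<Gamma> lam (\<lambda>\<omega>. blinfun_apply (G \<omega>) v)"
  by (simp add: expect_def blinfun.sum_left blinfun.scaleR_left)

lemma expect_mult_eq_inner_rho: "expect \<Gamma> lam (\<lambda>\<omega>. v \<omega> * w \<omega>) = inner_rho \<Gamma> lam v w"
  for v w :: "'w \<Rightarrow> real"
  by (simp add: expect_def inner_rho_def)

lemma dual_rho_cong:
  assumes "\<And>\<omega>. \<omega> \<in> \<Gamma> \<Longrightarrow> G \<omega> = G' \<omega>" "\<And>\<omega>. \<omega> \<in> \<Gamma> \<Longrightarrow> v \<omega> = v' \<omega>"
  shows "dual_rho \<Gamma> lam G v = dual_rho \<Gamma> lam G' v'"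
  unfolding dual_rho_def using assms by (intro sum.cong) auto

lemma dual_rho_add_right:
  "dual_rho \<Gamma> lam G (\<lambda>\<omega>. v \<omega> + w \<omega>) = dual_rho \<Gamma> lam G v + dual_rho \<Gamma> lam G w"
  by (simp add: dual_rho_def blinfun.add_right distrib_left sum.distrib)

lemma dual_rho_diff_right:
  "dual_rho \<Gamma> lam G (\<lambda>\<omega>. v \<omega> - w \<omega>) = dual_rho \<Gamma> lam G v - dual_rho \<Gamma> lam G w"
  by (simp add: dual_rho_def blinfun.diff_right right_diff_distrib sum_subtractf)

lemma dual_rho_sum_right:
  "dual_rho \<Gamma> lam G (\<lambda>\<omega>. \<Sum>j\<in>J. v j \<omega>) = (\<Sum>j\<in>J. dual_rho \<Gamma> lam G (v j))"
  unfolding dual_rho_def blinfun.sum_right sum_distrib_left by (rule sum.swap)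

text \<open>Links the scheme to its weak form: the equations for the mean and for the modes are
  exactly the weak form tested with product functions, random factor 1 or \<open>Y j\<close> times a
  deterministic element of \<open>Vh\<close>.\<close>

lemma dual_rho_scaleR_const:
  "dual_rho \<Gamma> lam G (\<lambda>\<omega>. y \<omega> *\<^sub>R a) = blinfun_apply (expect \<Gamma> lam (\<lambda>\<omega>. y \<omega> *\<^sub>R G \<omega>)) a"
  by (simp add: dual_rho_def expect_def blinfun.sum_left blinfun.scaleR_left blinfun.scaleR_right
      mult.assoc)

lemma dual_rho_const:
  "dual_rho \<Gamma> lam G (\<lambda>\<omega>. a) = blinfun_apply (expect \<Gamma> lam G) a"
  using dual_rho_scaleR_const[of \<Gamma> lam G "\<lambda>_. 1" a] by simp

lemma dual_rho_const_left:
  "dual_rho \<Gamma> lam (\<lambda>\<omega>. F) v = blinfun_apply F (expect \<Gamma> lam v)"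
  by (simp add: dual_rho_def expect_def blinfun.sum_right blinfun.scaleR_right)

lemma dual_rho_diff_left:
  "dual_rho \<Gamma> lam (\<lambda>\<omega>. G \<omega> - F \<omega>) v = dual_rho \<Gamma> lam G v - dual_rho \<Gamma> lam F v"
  by (simp add: dual_rho_def blinfun.diff_left right_diff_distrib sum_subtractf)

lemma dual_rho_H_to_dual:
  "dual_rho \<Gamma> lam (\<lambda>\<omega>. H_to_dual \<iota> (g \<omega>)) v = inner_rho \<Gamma> lam g (\<lambda>\<omega>. blinfun_apply \<iota> (v \<omega>))"
  by (simp add: dual_rho_def inner_rho_def)

text \<open>Parseval's identity with vector coefficients: 1 and the \<open>Y j\<close> are
  orthonormal scalar functions, and \<open>Z\<close>, \<open>Z'\<close> are remainders orthogonal to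
  all of them. The moments of the first argument are computed to be \<open>a\<close> and the
  \<open>b k\<close>; expanding the second argument then needs nothing else.\<close>

lemma inner_rho_orthonormal_expansion:
  fixes J :: "'j set" and Y :: "'j \<Rightarrow> 'w \<Rightarrow> real" and Z Z' :: "'w \<Rightarrow> 'a::real_inner"
  assumes "finite J" and total: "(\<Sum>\<omega>\<in>\<Gamma>. lam \<omega>) = 1"
    and orth: "\<And>i j. i \<in> J \<Longrightarrow> j \<in> J \<Longrightarrow> inner_rho \<Gamma> lam (Y i) (Y j) = (if i = j then 1 else 0)"
    and mean: "\<And>j. j \<in> J \<Longrightarrow> expect \<Gamma> lam (Y j) = 0"
    and Z: "expect \<Gamma> lam Z = 0" "\<And>j. j \<in> J \<Longrightarrow> expect \<Gamma> lam (\<lambda>\<omega>. Y j \<omega> *\<^sub>R Z \<omega>) = 0"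
    and Z': "expect \<Gamma> lam Z' = 0" "\<And>j. j \<in> J \<Longrightarrow> expect \<Gamma> lam (\<lambda>\<omega>. Y j \<omega> *\<^sub>R Z' \<omega>) = 0"
  shows "inner_rho \<Gamma> lam (\<lambda>\<omega>. a + (\<Sum>j\<in>J. Y j \<omega> *\<^sub>R b j) + Z \<omega>)
                         (\<lambda>\<omega>. a' + (\<Sum>j\<in>J. Y j \<omega> *\<^sub>R b' j) + Z' \<omega>)
         = inner a a' + (\<Sum>j\<in>J. inner (b j) (b' j)) + inner_rho \<Gamma> lam Z Z'"
proof -
  let ?v = "\<lambda>\<omega>. a + (\<Sum>j\<in>J. Y j \<omega> *\<^sub>R b j) + Z \<omega>"
  have const: "expect \<Gamma> lam (\<lambda>\<omega>. a) = a"
    using total by (simp add: expect_def flip: scaleR_sum_left)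
  have "expect \<Gamma> lam ?v = a"
    using mean Z by (simp add: expect_add expect_sum expect_scaleR_const const)
  moreover have "expect \<Gamma> lam (\<lambda>\<omega>. Y k \<omega> *\<^sub>R ?v \<omega>) = b k" if k: "k \<in> J" for k
  proof -
    have "expect \<Gamma> lam (\<lambda>\<omega>. Y k \<omega> *\<^sub>R ?v \<omega>)
        = expect \<Gamma> lam (Y k) *\<^sub>R a + (\<Sum>j\<in>J. expect \<Gamma> lam (\<lambda>\<omega>. Y k \<omega> * Y j \<omega>) *\<^sub>R b j)
          + expect \<Gamma> lam (\<lambda>\<omega>. Y k \<omega> *\<^sub>R Z \<omega>)"
      by (simp add: scaleR_add_right scaleR_sum_right expect_add expect_sum
          flip: expect_scaleR_const)
    also have "\<dots> = (\<Sum>j\<in>J. (if k = j then b j else 0))"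
      using k mean Z orth by (simp add: expect_mult_eq_inner_rho if_distrib[of "\<lambda>x. x *\<^sub>R _"] cong: if_cong)
    finally show ?thesis using k \<open>finite J\<close> by simp
  qed
  \<comment> \<open>Against \<open>Z'\<close> the constant and the \<open>Y j\<close> parts of the
    first argument contribute only moments of \<open>Z'\<close>, which vanish.\<close>
  moreover have "inner_rho \<Gamma> lam ?v Z' = inner_rho \<Gamma> lam Z Z'"
  proof -
    have "inner_rho \<Gamma> lam Z' ?v = inner_rho \<Gamma> lam Z' Z"
      using Z' by (simp add: inner_rho_add_right inner_rho_sum_right inner_rho_const_right
          inner_rho_scaleR_const_right)
    then show ?thesis by (simp add: inner_rho_commute)
  qed
  ultimately show ?thesis
    by (simp add: inner_rho_add_right inner_rho_sum_right inner_rho_const_right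
        inner_rho_scaleR_const_right)
qed

subsection \<open>The increment of one step\<close>

locale weighted_sample =
  fixes \<Gamma> :: "'w set" and lam :: "'w \<Rightarrow> real"
  assumes finite_sample: "finite \<Gamma>"
    and weight_pos: "\<omega> \<in> \<Gamma> \<Longrightarrow> lam \<omega> > 0"
    and weight_sum: "(\<Sum>\<omega>\<in>\<Gamma>. lam \<omega>) = 1"
begin

section \<open>Definiteness of the weighted inner product and the orthogonal projection\<close>

lemma inner_rho_nonneg: "inner_rho \<Gamma> lam v v \<ge> 0"
  unfolding inner_rho_def using weight_pos by (intro sum_nonneg) (simp add: less_imp_le)

lemma norm_rho_power2: "(norm_rho \<Gamma> lam v)\<^sup>2 = inner_rho \<Gamma> lam v v"
  unfolding norm_rho_def using inner_rho_nonneg by simp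

lemma inner_rho_self_eq_0D:
  assumes "inner_rho \<Gamma> lam v v = 0" "\<omega> \<in> \<Gamma>"
  shows "v \<omega> = 0"
proof -
  have "\<forall>\<omega>\<in>\<Gamma>. lam \<omega> * inner (v \<omega>) (v \<omega>) = 0"
    using assms(1) weight_pos unfolding inner_rho_def
    by (subst (asm) sum_nonneg_eq_0_iff) (auto simp: finite_sample less_imp_le)
  then show ?thesis using assms(2) weight_pos by force
qed

lemma sum_weighted_mono:
  assumes "\<And>\<omega>. \<omega> \<in> \<Gamma> \<Longrightarrow> a \<omega> \<le> b \<omega>"
  shows "(\<Sum>\<omega>\<in>\<Gamma>. lam \<omega> * a \<omega>) \<le> (\<Sum>\<omega>\<in>\<Gamma>. lam \<omega> * b \<omega>)"
  using assms weight_pos by (intro sum_mono mult_left_mono) (auto simp: less_imp_le)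

text \<open>\<open>L2_proj\<close> is a choice, so it is identified through uniqueness. The explicit
  candidate satisfies the defining property, which both shows that the choice is meaningful and
  gives something to compare it with.\<close>

lemma L2_proj_orth_compl_eq:
  assumes orth: "\<And>i j. i \<in> {1..R} \<Longrightarrow> j \<in> {1..R} \<Longrightarrow>
      inner_rho \<Gamma> lam (Y i) (Y j) = (if i = j then 1 else 0)"
    and "\<omega> \<in> \<Gamma>"
  shows "L2_proj \<Gamma> lam (L2_orth_compl \<Gamma> lam (L2_span \<Gamma> R Y)) v \<omega>
         = v \<omega> - (\<Sum>k=1..R. inner_rho \<Gamma> lam v (Y k) * Y k \<omega>)"
proof -
  let ?S = "L2_orth_compl \<Gamma> lam (L2_span \<Gamma> R Y)"
  define w where "w = (\<lambda>\<omega>. v \<omega> - (\<Sum>k=1..R. inner_rho \<Gamma> lam v (Y k) * Y k \<omega>))"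
  define w' where "w' = L2_proj \<Gamma> lam ?S v"
  have Y_span: "Y k \<in> L2_span \<Gamma> R Y" if "k \<in> {1..R}" for k
    unfolding L2_span_def using that
    by (auto intro!: exI[of _ "\<lambda>j. if j = k then 1 else 0"] simp: if_distrib[of "\<lambda>x. x * _"] cong: if_cong)
  have w_Y: "inner_rho \<Gamma> lam w (Y j) = 0" if "j \<in> {1..R}" for j
  proof -
    have "inner_rho \<Gamma> lam (Y j) w = inner_rho \<Gamma> lam (Y j) v
        - (\<Sum>k=1..R. inner_rho \<Gamma> lam v (Y k) * inner_rho \<Gamma> lam (Y j) (Y k))"
      unfolding w_def by (simp add: inner_rho_diff_right inner_rho_sum_right inner_rho_mult_right)
    also have "\<dots> = inner_rho \<Gamma> lam (Y j) v
        - (\<Sum>k=1..R. if j = k then inner_rho \<Gamma> lam v (Y k) else 0)"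
      using that orth by (intro arg_cong2[of _ _ _ _ minus] sum.cong) auto
    finally show ?thesis using that by (simp add: inner_rho_commute)
  qed
  have w_S: "w \<in> ?S"
    unfolding L2_orth_compl_def L2_span_def
  proof clarify
    fix s c assume "\<forall>\<omega>\<in>\<Gamma>. s \<omega> = (\<Sum>j = 1..R. c j * Y j \<omega>)"
    then have "inner_rho \<Gamma> lam w s = inner_rho \<Gamma> lam w (\<lambda>\<omega>. \<Sum>j = 1..R. c j * Y j \<omega>)"
      by (intro inner_rho_cong) auto
    then show "inner_rho \<Gamma> lam w s = 0"
      using w_Y by (simp add: inner_rho_sum_right inner_rho_mult_right)
  qed
  have perp: "inner_rho \<Gamma> lam (\<lambda>\<omega>. v \<omega> - w \<omega>) s = 0" if "s \<in> ?S" for s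
  proof -
    have "inner_rho \<Gamma> lam s (\<lambda>\<omega>. v \<omega> - w \<omega>) = 0"
      using that Y_span unfolding w_def L2_orth_compl_def
      by (simp add: inner_rho_sum_right inner_rho_mult_right)
    then show ?thesis by (simp add: inner_rho_commute)
  qed
  have "w' \<in> ?S \<and> (\<forall>s\<in>?S. inner_rho \<Gamma> lam (\<lambda>\<omega>. v \<omega> - w' \<omega>) s = 0)"
    unfolding w'_def L2_proj_def by (rule someI[of _ w]) (use w_S perp in auto)
  then have w'_S: "w' \<in> ?S"
    and perp': "\<And>s. s \<in> ?S \<Longrightarrow> inner_rho \<Gamma> lam (\<lambda>\<omega>. v \<omega> - w' \<omega>) s = 0" by auto
  \<comment> \<open>The difference of the two candidates lies in the subspace and is orthogonal to
    it, hence to itself; positive weights force it to vanish at each sample point.\<close>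
  have diff_S: "(\<lambda>\<omega>. w' \<omega> - w \<omega>) \<in> ?S"
    using w_S w'_S unfolding L2_orth_compl_def by (simp add: inner_rho_diff_left)
  have "inner_rho \<Gamma> lam (\<lambda>\<omega>. w' \<omega> - w \<omega>) (\<lambda>\<omega>. w' \<omega> - w \<omega>) = 0"
    using perp[OF diff_S] perp'[OF diff_S] by (simp add: inner_rho_diff_left)
  then have "w' \<omega> - w \<omega> = 0"
    using inner_rho_self_eq_0D[of "\<lambda>\<omega>. w' \<omega> - w \<omega>"] \<open>\<omega> \<in> \<Gamma>\<close> by blast
  then show ?thesis by (simp add: w_def w'_def)
qed

text \<open>The increment \<open>Z\<close> of the stochastic modes is orthogonal to the span of 1 and the \<open>Y j\<close>
  although \<open>Yt - Y\<close> need not be when the mass matrix is singular: the expectations of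
  \<open>Z\<close> and \<open>Y k *\<^sub>R Z\<close> lie in the span of \<open>Ut\<close>, and by the stochastic equation they are
  H-orthogonal to it. This makes the minimality condition on \<open>Yt\<close> irrelevant.\<close>

lemma stoch_increment:
  fixes \<iota> :: "'v::real_inner \<Rightarrow>\<^sub>L 'h::real_inner"
  assumes inj: "inj (blinfun_apply \<iota>)" and dt: "dt > 0"
    and orth: "\<And>i j. i \<in> {1..R} \<Longrightarrow> j \<in> {1..R} \<Longrightarrow>
      inner_rho \<Gamma> lam (Y i) (Y j) = (if i = j then 1 else 0)"
    and mean: "\<And>j. j \<in> {1..R} \<Longrightarrow> expect \<Gamma> lam (Y j) = 0"
    and eq: "stoch_eq \<iota> \<Gamma> lam R dt G Y Ut Yt"
  defines "Z \<equiv> \<lambda>\<omega>. \<Sum>j=1..R. (Yt j \<omega> - Y j \<omega>) *\<^sub>R Ut j"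
  shows "expect \<Gamma> lam Z = 0"
    and "\<And>k. k \<in> {1..R} \<Longrightarrow> expect \<Gamma> lam (\<lambda>\<omega>. Y k \<omega> *\<^sub>R Z \<omega>) = 0"
    and "inner_rho \<Gamma> lam (\<lambda>\<omega>. blinfun_apply \<iota> (Z \<omega>)) (\<lambda>\<omega>. blinfun_apply \<iota> (Z \<omega>))
         = - dt * dual_rho \<Gamma> lam G Z"
proof -
  define D where "D j \<omega> = Yt j \<omega> - Y j \<omega>" for j \<omega>
  define g where "g j \<omega> = blinfun_apply (centered \<Gamma> lam G \<omega>) (Ut j)" for j \<omega>
  \<comment> \<open>The projected right-hand side in explicit form. It is orthogonal to each
    \<open>Y k\<close> by construction, and to 1 because centering removes the mean of
    \<open>g j\<close> while the \<open>Y k\<close> have mean zero.\<close>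
  define P where "P j \<omega> = g j \<omega> - (\<Sum>k=1..R. inner_rho \<Gamma> lam (g j) (Y k) * Y k \<omega>)" for j \<omega>
  have Z_D: "Z \<omega> = (\<Sum>j=1..R. D j \<omega> *\<^sub>R Ut j)" for \<omega> by (simp add: Z_def D_def)
  have P_Y: "inner_rho \<Gamma> lam (Y k) (P j) = 0" if "k \<in> {1..R}" for j k
  proof -
    have "inner_rho \<Gamma> lam (Y k) (P j) = inner_rho \<Gamma> lam (Y k) (g j)
        - (\<Sum>i=1..R. inner_rho \<Gamma> lam (g j) (Y i) * inner_rho \<Gamma> lam (Y k) (Y i))"
      unfolding P_def by (simp add: inner_rho_diff_right inner_rho_sum_right inner_rho_mult_right)
    also have "\<dots> = inner_rho \<Gamma> lam (Y k) (g j)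
        - (\<Sum>i=1..R. if k = i then inner_rho \<Gamma> lam (g j) (Y i) else 0)"
      using that orth by (intro arg_cong2[of _ _ _ _ minus] sum.cong) auto
    finally show ?thesis using that by (simp add: inner_rho_commute)
  qed
  have E_const: "expect \<Gamma> lam (\<lambda>\<omega>. x) = x" for x :: real
    using weight_sum by (simp add: expect_def flip: sum_distrib_right)
  have one_Y: "inner_rho \<Gamma> lam (\<lambda>_. 1) (Y k) = 0" if "k \<in> {1..R}" for k
    using mean[OF that] by (simp add: inner_rho_def expect_def)
  have one_g: "inner_rho \<Gamma> lam (\<lambda>_. 1) (g j) = 0" for j
  proof -
    have "inner_rho \<Gamma> lam (\<lambda>_. 1) (g j)
        = expect \<Gamma> lam (\<lambda>\<omega>. blinfun_apply (G \<omega>) (Ut j))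
          - expect \<Gamma> lam (\<lambda>\<omega>. blinfun_apply (expect \<Gamma> lam G) (Ut j))"
      by (simp add: inner_rho_def g_def centered_def blinfun.diff_left expect_def
          right_diff_distrib sum_subtractf)
    then show ?thesis by (simp add: E_const blinfun_apply_expect)
  qed
  have P_1: "inner_rho \<Gamma> lam (\<lambda>_. 1) (P j) = 0" for j
    unfolding P_def by (simp add: inner_rho_diff_right inner_rho_sum_right inner_rho_mult_right one_g one_Y)
  \<comment> \<open>Summing against the mass matrix is taking the H inner product of
    \<open>Z\<close> with \<open>Ut j\<close>. At a fixed sample point the stochastic equation is
    thus a weak equation for \<open>Z\<close>, obtained without inverting the mass matrix.\<close>
  have tested: "inner (blinfun_apply \<iota> (Z \<omega>)) (blinfun_apply \<iota> (Ut j)) = - dt * P j \<omega>"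
    if "j \<in> {1..R}" "\<omega> \<in> \<Gamma>" for j \<omega>
  proof -
    have "(\<Sum>i=1..R. (Yt i \<omega> - Y i \<omega>) / dt * mass_mat \<iota> Ut i j) + P j \<omega> = 0"
    proof -
      have "L2_proj \<Gamma> lam (L2_orth_compl \<Gamma> lam (L2_span \<Gamma> R Y)) (g j) \<omega> = P j \<omega>"
        unfolding P_def by (rule L2_proj_orth_compl_eq[OF orth that(2)])
      then show ?thesis
        using eq[unfolded stoch_eq_def, rule_format, OF that] unfolding g_def by (simp only:)
    qed
    moreover have "inner (blinfun_apply \<iota> (Z \<omega>)) (blinfun_apply \<iota> (Ut j))
        = dt * (\<Sum>i=1..R. (Yt i \<omega> - Y i \<omega>) / dt * mass_mat \<iota> Ut i j)"
      using dt by (simp add: Z_def blinfun.sum_right blinfun.scaleR_right inner_sum_left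
          sum_distrib_left mass_mat_def)
    ultimately show ?thesis by (simp add: add_eq_0_iff)
  qed
  \<comment> \<open>To be used with \<open>q\<close> equal to the constant 1 and to each
    \<open>Y k\<close>.\<close>
  have orth_Z: "expect \<Gamma> lam (\<lambda>\<omega>. q \<omega> *\<^sub>R Z \<omega>) = 0"
    if q: "\<And>j. j \<in> {1..R} \<Longrightarrow> inner_rho \<Gamma> lam q (P j) = 0" for q
  proof -
    let ?e = "expect \<Gamma> lam (\<lambda>\<omega>. q \<omega> *\<^sub>R Z \<omega>)"
    have e_Ut: "inner (blinfun_apply \<iota> ?e) (blinfun_apply \<iota> (Ut j)) = 0" if "j \<in> {1..R}" for j
    proof -
      have "inner (blinfun_apply \<iota> ?e) (blinfun_apply \<iota> (Ut j))
          = (\<Sum>\<omega>\<in>\<Gamma>. lam \<omega> * (q \<omega> * inner (blinfun_apply \<iota> (Z \<omega>)) (blinfun_apply \<iota> (Ut j))))"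
        by (simp add: expect_def blinfun.sum_right blinfun.scaleR_right inner_sum_left mult.assoc)
      also have "\<dots> = (\<Sum>\<omega>\<in>\<Gamma>. - dt * (lam \<omega> * (q \<omega> * P j \<omega>)))"
        using that tested by (intro sum.cong) auto
      also have "\<dots> = - dt * inner_rho \<Gamma> lam q (P j)"
        by (simp add: inner_rho_def sum_distrib_left)
      finally show ?thesis using q[OF that] by simp
    qed
    have "?e = (\<Sum>j=1..R. inner_rho \<Gamma> lam q (D j) *\<^sub>R Ut j)"
    proof -
      have "?e = expect \<Gamma> lam (\<lambda>\<omega>. \<Sum>j=1..R. (q \<omega> * D j \<omega>) *\<^sub>R Ut j)"
        by (simp add: Z_D scaleR_sum_right)
      also have "\<dots> = (\<Sum>j=1..R. inner_rho \<Gamma> lam q (D j) *\<^sub>R Ut j)"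
        by (simp only: expect_sum expect_scaleR_const expect_mult_eq_inner_rho)
      finally show ?thesis .
    qed
    then have "blinfun_apply \<iota> ?e = (\<Sum>j=1..R. inner_rho \<Gamma> lam q (D j) *\<^sub>R blinfun_apply \<iota> (Ut j))"
      by (simp add: blinfun.sum_right blinfun.scaleR_right)
    from arg_cong[OF this, of "inner (blinfun_apply \<iota> ?e)"]
    have "inner (blinfun_apply \<iota> ?e) (blinfun_apply \<iota> ?e)
        = (\<Sum>j=1..R. inner_rho \<Gamma> lam q (D j) * inner (blinfun_apply \<iota> ?e) (blinfun_apply \<iota> (Ut j)))"
      by (simp only: inner_sum_right inner_scaleR_right)
    then have "blinfun_apply \<iota> ?e = blinfun_apply \<iota> 0"
      using e_Ut by simp
    then show ?thesis using inj by (rule injD[rotated])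
  qed
  show E_Z: "expect \<Gamma> lam Z = 0"
    using orth_Z[of "\<lambda>_. 1"] P_1 by simp
  show E_YZ: "expect \<Gamma> lam (\<lambda>\<omega>. Y k \<omega> *\<^sub>R Z \<omega>) = 0" if "k \<in> {1..R}" for k
    using orth_Z[of "Y k"] P_Y[OF that] by simp
  have sum_g: "(\<Sum>j=1..R. D j \<omega> * g j \<omega>) = blinfun_apply (centered \<Gamma> lam G \<omega>) (Z \<omega>)" for \<omega>
    by (simp add: g_def Z_D blinfun.sum_right blinfun.scaleR_right)
  \<comment> \<open>The individual numbers \<open>inner_rho \<Gamma> lam (D j) (Y k)\<close> may be
    nonzero. The sum vanishes because it is a single functional, the \<open>Y k\<close> moment of
    the centered \<open>G\<close>, evaluated at the \<open>Y k\<close> moment of \<open>Z\<close>.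
    This removes the projection from the identity for \<open>Z\<close>.\<close>
  have g_Y: "(\<Sum>j=1..R. inner_rho \<Gamma> lam (g j) (Y k) * inner_rho \<Gamma> lam (D j) (Y k)) = 0"
    if k: "k \<in> {1..R}" for k
  proof -
    let ?F = "expect \<Gamma> lam (\<lambda>\<omega>. Y k \<omega> *\<^sub>R centered \<Gamma> lam G \<omega>)"
    have "0 = blinfun_apply ?F (expect \<Gamma> lam (\<lambda>\<omega>. Y k \<omega> *\<^sub>R Z \<omega>))"
      using E_YZ[OF k] by simp
    also have "expect \<Gamma> lam (\<lambda>\<omega>. Y k \<omega> *\<^sub>R Z \<omega>) = expect \<Gamma> lam (\<lambda>\<omega>. \<Sum>j=1..R. (D j \<omega> * Y k \<omega>) *\<^sub>R Ut j)"
      by (simp add: Z_D scaleR_sum_right mult.commute)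
    also have "\<dots> = (\<Sum>j=1..R. inner_rho \<Gamma> lam (D j) (Y k) *\<^sub>R Ut j)"
      by (simp only: expect_sum expect_scaleR_const expect_mult_eq_inner_rho)
    also have "blinfun_apply ?F \<dots>
        = (\<Sum>j=1..R. inner_rho \<Gamma> lam (D j) (Y k) * blinfun_apply ?F (Ut j))"
      by (simp add: blinfun.sum_right blinfun.scaleR_right)
    also have "\<dots> = (\<Sum>j=1..R. inner_rho \<Gamma> lam (g j) (Y k) * inner_rho \<Gamma> lam (D j) (Y k))"
      by (intro sum.cong refl) (simp add: inner_rho_def expect_def g_def blinfun.sum_left
          blinfun.scaleR_left mult_ac)
    finally show ?thesis by simp
  qed
  have "inner_rho \<Gamma> lam (\<lambda>\<omega>. blinfun_apply \<iota> (Z \<omega>)) (\<lambda>\<omega>. blinfun_apply \<iota> (Z \<omega>))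
      = (\<Sum>\<omega>\<in>\<Gamma>. lam \<omega> * (\<Sum>j=1..R. D j \<omega> * (- dt * P j \<omega>)))"
    unfolding inner_rho_def
  proof (intro sum.cong refl arg_cong2[of _ _ _ _ times])
    fix \<omega> assume "\<omega> \<in> \<Gamma>"
    have "inner (blinfun_apply \<iota> (Z \<omega>)) (blinfun_apply \<iota> (Z \<omega>))
        = inner (blinfun_apply \<iota> (Z \<omega>)) (\<Sum>j=1..R. D j \<omega> *\<^sub>R blinfun_apply \<iota> (Ut j))"
      by (subst (2) Z_D) (simp add: blinfun.sum_right blinfun.scaleR_right)
    also have "\<dots> = (\<Sum>j=1..R. D j \<omega> * (- dt * P j \<omega>))"
      using tested \<open>\<omega> \<in> \<Gamma>\<close> by (simp add: inner_sum_right)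
    finally show "inner (blinfun_apply \<iota> (Z \<omega>)) (blinfun_apply \<iota> (Z \<omega>))
        = (\<Sum>j=1..R. D j \<omega> * (- dt * P j \<omega>))" .
  qed
  also have "\<dots> = - dt * (\<Sum>j=1..R. inner_rho \<Gamma> lam (D j) (P j))"
    unfolding inner_rho_def
    by (subst sum.swap) (simp add: sum_distrib_left mult_ac sum_negf)
  also have "(\<Sum>j=1..R. inner_rho \<Gamma> lam (D j) (P j))
      = (\<Sum>j=1..R. inner_rho \<Gamma> lam (D j) (g j))
        - (\<Sum>j=1..R. \<Sum>k=1..R. inner_rho \<Gamma> lam (g j) (Y k) * inner_rho \<Gamma> lam (D j) (Y k))"
    unfolding P_def
    by (simp add: inner_rho_diff_right inner_rho_sum_right inner_rho_mult_right sum_subtractf)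
  also have "(\<Sum>j=1..R. \<Sum>k=1..R. inner_rho \<Gamma> lam (g j) (Y k) * inner_rho \<Gamma> lam (D j) (Y k)) = 0"
    by (subst sum.swap) (use g_Y in simp)
  also have "(\<Sum>j=1..R. inner_rho \<Gamma> lam (D j) (g j)) = dual_rho \<Gamma> lam (centered \<Gamma> lam G) Z"
    unfolding inner_rho_def dual_rho_def sum_g[symmetric]
    by (subst sum.swap) (simp add: sum_distrib_left)
  \<comment> \<open>The centering subtracts one fixed functional, which sees only the mean of
    \<open>Z\<close>.\<close>
  also have "\<dots> = dual_rho \<Gamma> lam G Z"
    unfolding centered_def by (simp add: dual_rho_diff_left dual_rho_const_left E_Z)
  finally show "inner_rho \<Gamma> lam (\<lambda>\<omega>. blinfun_apply \<iota> (Z \<omega>)) (\<lambda>\<omega>. blinfun_apply \<iota> (Z \<omega>))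
      = - dt * dual_rho \<Gamma> lam G Z" by simp
qed

text \<open>Increment and test function are expanded in the same frame 1, \<open>Y j\<close>,
  remainder. The orthonormal expansion then splits the tested identity into the mean equation at
  \<open>a\<close>, the mode equations at \<open>b j\<close>, and the identity of \<open>Z\<close>
  with itself.\<close>

lemma dlr_step_tested:
  fixes \<iota> :: "'v::real_inner \<Rightarrow>\<^sub>L 'h::real_inner"
  assumes inj: "inj (blinfun_apply \<iota>)" and dt: "dt > 0"
    and factors: "dlr_factors \<Gamma> lam Vh R ub U Y"
    and step: "dlr_step \<iota> \<Gamma> lam Vh R dt G ub U Y ub' U' Y'"
    and u: "\<And>\<omega>. \<omega> \<in> \<Gamma> \<Longrightarrow> u \<omega> = dlr_fun R ub U Y \<omega>"
    and u': "\<And>\<omega>. \<omega> \<in> \<Gamma> \<Longrightarrow> u' \<omega> = dlr_fun R ub' U' Y' \<omega>"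
  shows "inner_rho \<Gamma> lam (\<lambda>\<omega>. blinfun_apply \<iota> (u' \<omega> - u \<omega>)) (\<lambda>\<omega>. blinfun_apply \<iota> (u \<omega>))
         = - dt * dual_rho \<Gamma> lam G u"
    and "inner_rho \<Gamma> lam (\<lambda>\<omega>. blinfun_apply \<iota> (u' \<omega> - u \<omega>)) (\<lambda>\<omega>. blinfun_apply \<iota> (u' \<omega>))
         = - dt * dual_rho \<Gamma> lam G u'"
proof -
  have ub: "ub \<in> Vh" and U: "\<And>j. j \<in> {1..R} \<Longrightarrow> U j \<in> Vh"
    and orth: "\<And>i j. i \<in> {1..R} \<Longrightarrow> j \<in> {1..R} \<Longrightarrow>
      inner_rho \<Gamma> lam (Y i) (Y j) = (if i = j then 1 else 0)"
    and mean: "\<And>j. j \<in> {1..R} \<Longrightarrow> expect \<Gamma> lam (Y j) = 0"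
    using factors unfolding dlr_factors_def by blast+
  obtain Ut Yt where ub': "ub' \<in> Vh"
    and eq0: "\<And>v. v \<in> Vh \<Longrightarrow> inner (blinfun_apply \<iota> ((ub' - ub) /\<^sub>R dt)) (blinfun_apply \<iota> v)
              + blinfun_apply (expect \<Gamma> lam G) v = 0"
    and Ut: "\<And>j. j \<in> {1..R} \<Longrightarrow> Ut j \<in> Vh"
    and eq1: "\<And>j v. j \<in> {1..R} \<Longrightarrow> v \<in> Vh \<Longrightarrow>
        inner (blinfun_apply \<iota> ((Ut j - U j) /\<^sub>R dt)) (blinfun_apply \<iota> v)
        + blinfun_apply (expect \<Gamma> lam (\<lambda>\<omega>. Y j \<omega> *\<^sub>R G \<omega>)) v = 0"
    and seq: "stoch_eq \<iota> \<Gamma> lam R dt G Y Ut Yt"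
    and reorth: "\<And>\<omega>. \<omega> \<in> \<Gamma> \<Longrightarrow> (\<Sum>j=1..R. Y' j \<omega> *\<^sub>R U' j) = (\<Sum>j=1..R. Yt j \<omega> *\<^sub>R Ut j)"
    using step unfolding dlr_step_def by blast
  define Z where "Z = (\<lambda>\<omega>. \<Sum>j=1..R. (Yt j \<omega> - Y j \<omega>) *\<^sub>R Ut j)"
  note incr = stoch_increment[OF inj dt orth mean seq]
  have Z: "expect \<Gamma> lam Z = 0"
    unfolding Z_def by (rule incr(1))
  have YZ: "\<And>k. k \<in> {1..R} \<Longrightarrow> expect \<Gamma> lam (\<lambda>\<omega>. Y k \<omega> *\<^sub>R Z \<omega>) = 0"
    unfolding Z_def by (rule incr(2))
  have ZZ: "inner_rho \<Gamma> lam (\<lambda>\<omega>. blinfun_apply \<iota> (Z \<omega>)) (\<lambda>\<omega>. blinfun_apply \<iota> (Z \<omega>))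
      = - dt * dual_rho \<Gamma> lam G Z"
    unfolding Z_def by (rule incr(3))
  have \<iota>Z: "expect \<Gamma> lam (\<lambda>\<omega>. blinfun_apply \<iota> (Z \<omega>)) = 0"
    "\<And>k. k \<in> {1..R} \<Longrightarrow> expect \<Gamma> lam (\<lambda>\<omega>. Y k \<omega> *\<^sub>R blinfun_apply \<iota> (Z \<omega>)) = 0"
    using Z YZ by (simp_all add: expect_blinfun_apply[symmetric] flip: blinfun.scaleR_right)
  \<comment> \<open>Reorthonormalization leaves the product of the factors unchanged, so
    \<open>Yt\<close> and \<open>Ut\<close> may replace \<open>Y'\<close> and \<open>U'\<close>;
    splitting \<open>Yt\<close> as \<open>Y\<close> plus its change isolates
    \<open>Z\<close>.\<close>
  have u'_Z: "u' \<omega> = ub' + (\<Sum>j=1..R. Y j \<omega> *\<^sub>R Ut j) + Z \<omega>" if "\<omega> \<in> \<Gamma>" for \<omega>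
    using u'[OF that] reorth[OF that]
    by (simp add: dlr_fun_def Z_def scaleR_diff_left sum_subtractf)
  have diff: "u' \<omega> - u \<omega> = (ub' - ub) + (\<Sum>j=1..R. Y j \<omega> *\<^sub>R (Ut j - U j)) + Z \<omega>"
    if "\<omega> \<in> \<Gamma>" for \<omega>
    using u'_Z[OF that] u[OF that]
    by (simp add: dlr_fun_def scaleR_diff_right sum_subtractf)
  have quotient: "inner (blinfun_apply \<iota> (x /\<^sub>R dt)) z = inner (blinfun_apply \<iota> x) z / dt" for x z
    by (simp only: blinfun.scaleR_right inner_scaleR_left divide_inverse mult.commute)
  have weak0: "inner (blinfun_apply \<iota> (ub' - ub)) (blinfun_apply \<iota> v)
      = - dt * blinfun_apply (expect \<Gamma> lam G) v" if "v \<in> Vh" for v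
    using eq0[OF that] dt unfolding quotient by (simp add: field_simps)
  have weak1: "inner (blinfun_apply \<iota> (Ut j - U j)) (blinfun_apply \<iota> v)
      = - dt * blinfun_apply (expect \<Gamma> lam (\<lambda>\<omega>. Y j \<omega> *\<^sub>R G \<omega>)) v" if "j \<in> {1..R}" "v \<in> Vh" for j v
    using eq1[OF that] dt unfolding quotient by (simp add: field_simps)
  \<comment> \<open>The remainder \<open>Z'\<close> is 0 when testing with \<open>u\<close> and
    \<open>Z\<close> when testing with \<open>u'\<close>.\<close>
  have tested: "inner_rho \<Gamma> lam (\<lambda>\<omega>. blinfun_apply \<iota> (u' \<omega> - u \<omega>)) (\<lambda>\<omega>. blinfun_apply \<iota> (v \<omega>))
      = - dt * dual_rho \<Gamma> lam G v"
    if v: "\<And>\<omega>. \<omega> \<in> \<Gamma> \<Longrightarrow> v \<omega> = a + (\<Sum>j=1..R. Y j \<omega> *\<^sub>R b j) + Z' \<omega>"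
      and a: "a \<in> Vh" and b: "\<And>j. j \<in> {1..R} \<Longrightarrow> b j \<in> Vh"
      and Z': "Z' = Z \<or> Z' = (\<lambda>\<omega>. 0)" for v a b Z'
  proof -
    have "inner_rho \<Gamma> lam (\<lambda>\<omega>. blinfun_apply \<iota> (u' \<omega> - u \<omega>)) (\<lambda>\<omega>. blinfun_apply \<iota> (v \<omega>))
      = inner_rho \<Gamma> lam
          (\<lambda>\<omega>. blinfun_apply \<iota> (ub' - ub) + (\<Sum>j=1..R. Y j \<omega> *\<^sub>R blinfun_apply \<iota> (Ut j - U j))
               + blinfun_apply \<iota> (Z \<omega>))
          (\<lambda>\<omega>. blinfun_apply \<iota> a + (\<Sum>j=1..R. Y j \<omega> *\<^sub>R blinfun_apply \<iota> (b j))
               + blinfun_apply \<iota> (Z' \<omega>))"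
      by (intro inner_rho_cong)
        (simp_all add: diff v blinfun.add_right blinfun.sum_right blinfun.scaleR_right)
    also have "\<dots> = inner (blinfun_apply \<iota> (ub' - ub)) (blinfun_apply \<iota> a)
        + (\<Sum>j=1..R. inner (blinfun_apply \<iota> (Ut j - U j)) (blinfun_apply \<iota> (b j)))
        + inner_rho \<Gamma> lam (\<lambda>\<omega>. blinfun_apply \<iota> (Z \<omega>)) (\<lambda>\<omega>. blinfun_apply \<iota> (Z' \<omega>))"
      by (rule inner_rho_orthonormal_expansion)
        (use weight_sum orth mean \<iota>Z Z' in \<open>auto simp: expect_def\<close>)
    also have "inner_rho \<Gamma> lam (\<lambda>\<omega>. blinfun_apply \<iota> (Z \<omega>)) (\<lambda>\<omega>. blinfun_apply \<iota> (Z' \<omega>))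
        = - dt * dual_rho \<Gamma> lam G Z'"
      using Z' ZZ by (auto simp: inner_rho_def dual_rho_def)
    also have "(\<Sum>j=1..R. inner (blinfun_apply \<iota> (Ut j - U j)) (blinfun_apply \<iota> (b j)))
        = (\<Sum>j=1..R. - dt * blinfun_apply (expect \<Gamma> lam (\<lambda>\<omega>. Y j \<omega> *\<^sub>R G \<omega>)) (b j))"
      using weak1 b by (intro sum.cong) auto
    also have "\<dots> = - dt * (\<Sum>j=1..R. dual_rho \<Gamma> lam G (\<lambda>\<omega>. Y j \<omega> *\<^sub>R b j))"
      by (simp add: dual_rho_scaleR_const sum_distrib_left)
    also have "inner (blinfun_apply \<iota> (ub' - ub)) (blinfun_apply \<iota> a)
        = - dt * dual_rho \<Gamma> lam G (\<lambda>\<omega>. a)"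
      by (simp only: weak0[OF a] dual_rho_const)
    also have "- dt * dual_rho \<Gamma> lam G (\<lambda>\<omega>. a)
        + - dt * (\<Sum>j=1..R. dual_rho \<Gamma> lam G (\<lambda>\<omega>. Y j \<omega> *\<^sub>R b j)) + - dt * dual_rho \<Gamma> lam G Z'
        = - dt * dual_rho \<Gamma> lam G (\<lambda>\<omega>. a + (\<Sum>j=1..R. Y j \<omega> *\<^sub>R b j) + Z' \<omega>)"
      by (simp add: dual_rho_add_right dual_rho_sum_right algebra_simps)
    also have "dual_rho \<Gamma> lam G (\<lambda>\<omega>. a + (\<Sum>j=1..R. Y j \<omega> *\<^sub>R b j) + Z' \<omega>) = dual_rho \<Gamma> lam G v"
      using v by (intro dual_rho_cong) auto
    finally show ?thesis .
  qed
  show "inner_rho \<Gamma> lam (\<lambda>\<omega>. blinfun_apply \<iota> (u' \<omega> - u \<omega>)) (\<lambda>\<omega>. blinfun_apply \<iota> (u \<omega>))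
      = - dt * dual_rho \<Gamma> lam G u"
    by (rule tested[of _ ub U "\<lambda>_. 0"]) (use u ub U in \<open>auto simp: dlr_fun_def\<close>)
  show "inner_rho \<Gamma> lam (\<lambda>\<omega>. blinfun_apply \<iota> (u' \<omega> - u \<omega>)) (\<lambda>\<omega>. blinfun_apply \<iota> (u' \<omega>))
      = - dt * dual_rho \<Gamma> lam G u'"
    by (rule tested[of _ ub' Ut Z]) (use u'_Z ub' Ut in auto)
qed

end

subsection \<open>Energy estimates\<close>

text \<open>Young's inequality. The weight is \<open>K\<close> for the operator error,
  \<open>C_L\<close> for the forcing measured through V, and \<kappa> / dt for the forcing measured
  in H.\<close>

lemma weighted_AM_GM:
  fixes x y \<epsilon> :: real
  assumes "\<epsilon> > 0"
  shows "2 * x * y \<le> x\<^sup>2 / \<epsilon> + \<epsilon> * y\<^sup>2"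
proof -
  have "0 \<le> (x - \<epsilon> * y)\<^sup>2 / \<epsilon>" using assms by simp
  also have "\<dots> = x\<^sup>2 / \<epsilon> + \<epsilon> * y\<^sup>2 - 2 * x * y"
    using assms by (simp add: field_simps power2_eq_square)
  finally show ?thesis by simp
qed

lemma sum_telescope_le:
  fixes a b c :: "nat \<Rightarrow> real"
  assumes "\<And>n. n < N \<Longrightarrow> a (Suc n) + b n \<le> a n + c n"
  shows "a N + (\<Sum>n=0..<N. b n) \<le> a 0 + (\<Sum>n=0..<N. c n)"
  using assms
proof (induction N)
  case (Suc N)
  then have "a N + (\<Sum>n=0..<N. b n) \<le> a 0 + (\<Sum>n=0..<N. c n)" by simp
  with Suc.prems[of N] show ?case by simp
qed simp

text \<open>The interface between the scheme and the estimates: the low-rank structure survives only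
  in \<open>tested_u\<close> and \<open>tested_u'\<close>, and the inverse inequality only for the
  increment, squared, with \<open>K\<close> standing for C_I^2 / h^(2p).\<close>

locale explicit_galerkin_step = weighted_sample \<Gamma> lam
  for \<Gamma> :: "'w set" and lam :: "'w \<Rightarrow> real" +
  fixes \<iota> :: "'v::real_inner \<Rightarrow>\<^sub>L 'h::real_inner"
    and L :: "'w \<Rightarrow> 'v \<Rightarrow> ('v \<Rightarrow>\<^sub>L real)"
    and g :: "'w \<Rightarrow> 'h" and u u' :: "'w \<Rightarrow> 'v" and dt C_L C_B K :: real
  assumes dt_pos: "dt > 0" and C_B_pos: "C_B > 0" and K_pos: "K > 0" and C_L_pos: "C_L > 0"
    and tested_u: "inner_rho \<Gamma> lam (\<lambda>\<omega>. blinfun_apply \<iota> (u' \<omega> - u \<omega>)) (\<lambda>\<omega>. blinfun_apply \<iota> (u \<omega>))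
        = - dt * (inner_L L \<Gamma> lam u u - inner_rho \<Gamma> lam g (\<lambda>\<omega>. blinfun_apply \<iota> (u \<omega>)))"
    and tested_u': "inner_rho \<Gamma> lam (\<lambda>\<omega>. blinfun_apply \<iota> (u' \<omega> - u \<omega>)) (\<lambda>\<omega>. blinfun_apply \<iota> (u' \<omega>))
        = - dt * (inner_L L \<Gamma> lam u u' - inner_rho \<Gamma> lam g (\<lambda>\<omega>. blinfun_apply \<iota> (u' \<omega>)))"
    and linear_L: "\<And>\<omega>. \<omega> \<in> \<Gamma> \<Longrightarrow> linear (L \<omega>)"
    and coercive: "\<And>\<omega> v. \<omega> \<in> \<Gamma> \<Longrightarrow> C_L * (norm v)\<^sup>2 \<le> blinfun_apply (L \<omega> v) v"
    and bounded: "\<And>\<omega> v w. \<omega> \<in> \<Gamma> \<Longrightarrow> blinfun_apply (L \<omega> v) w \<le> C_B * norm v * norm w"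
    and inverse: "inner_rho \<Gamma> lam (\<lambda>\<omega>. u' \<omega> - u \<omega>) (\<lambda>\<omega>. u' \<omega> - u \<omega>)
        \<le> K * inner_rho \<Gamma> lam (\<lambda>\<omega>. blinfun_apply \<iota> (u' \<omega> - u \<omega>)) (\<lambda>\<omega>. blinfun_apply \<iota> (u' \<omega> - u \<omega>))"
begin

abbreviation sqV :: "('w \<Rightarrow> 'v) \<Rightarrow> real" where
  "sqV v \<equiv> inner_rho \<Gamma> lam v v"

abbreviation sqH :: "('w \<Rightarrow> 'v) \<Rightarrow> real" where
  "sqH v \<equiv> inner_rho \<Gamma> lam (\<lambda>\<omega>. blinfun_apply \<iota> (v \<omega>)) (\<lambda>\<omega>. blinfun_apply \<iota> (v \<omega>))"

abbreviation pairH :: "('w \<Rightarrow> 'h) \<Rightarrow> ('w \<Rightarrow> 'v) \<Rightarrow> real" where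
  "pairH x v \<equiv> inner_rho \<Gamma> lam x (\<lambda>\<omega>. blinfun_apply \<iota> (v \<omega>))"

abbreviation \<delta> :: "'w \<Rightarrow> 'v" where
  "\<delta> \<equiv> \<lambda>\<omega>. u' \<omega> - u \<omega>"

lemma inner_L_add_left:
  "inner_L L \<Gamma> lam (\<lambda>\<omega>. v \<omega> + w \<omega>) z = inner_L L \<Gamma> lam v z + inner_L L \<Gamma> lam w z"
  unfolding inner_L_def sum.distrib[symmetric] using linear_L
  by (intro sum.cong) (auto simp: linear_add blinfun.add_left distrib_left)

lemma inner_L_diff_left:
  "inner_L L \<Gamma> lam (\<lambda>\<omega>. v \<omega> - w \<omega>) z = inner_L L \<Gamma> lam v z - inner_L L \<Gamma> lam w z"
  unfolding inner_L_def sum_subtractf[symmetric] using linear_L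
  by (intro sum.cong) (auto simp: linear_diff blinfun.diff_left right_diff_distrib)

lemma inner_L_diff_right:
  "inner_L L \<Gamma> lam z (\<lambda>\<omega>. v \<omega> - w \<omega>) = inner_L L \<Gamma> lam z v - inner_L L \<Gamma> lam z w"
  by (simp add: inner_L_eq_dual_rho dual_rho_diff_right)

lemma inner_L_add_right:
  "inner_L L \<Gamma> lam z (\<lambda>\<omega>. v \<omega> + w \<omega>) = inner_L L \<Gamma> lam z v + inner_L L \<Gamma> lam z w"
  by (simp add: inner_L_eq_dual_rho dual_rho_add_right)

lemma inner_L_coercive: "C_L * sqV v \<le> inner_L L \<Gamma> lam v v"
proof -
  have "C_L * sqV v = (\<Sum>\<omega>\<in>\<Gamma>. lam \<omega> * (C_L * (norm (v \<omega>))\<^sup>2))"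
    by (simp add: inner_rho_def sum_distrib_left power2_norm_eq_inner mult_ac)
  also have "\<dots> \<le> inner_L L \<Gamma> lam v v"
    unfolding inner_L_def by (intro sum_weighted_mono coercive)
  finally show ?thesis .
qed

lemma inner_L_nonneg: "inner_L L \<Gamma> lam v v \<ge> 0"
  using inner_L_coercive[of v] C_L_pos inner_rho_nonneg[of v]
  by (meson mult_nonneg_nonneg less_imp_le order_trans)

lemma inner_L_bounded: "inner_L L \<Gamma> lam v v \<le> C_B * sqV v"
proof -
  have "inner_L L \<Gamma> lam v v \<le> (\<Sum>\<omega>\<in>\<Gamma>. lam \<omega> * (C_B * norm (v \<omega>) * norm (v \<omega>)))"
    unfolding inner_L_def by (intro sum_weighted_mono bounded)
  also have "\<dots> = C_B * sqV v"
    by (simp add: inner_rho_def sum_distrib_left dot_square_norm power2_eq_square mult_ac)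
  finally show ?thesis .
qed

lemma inner_L_increment_bounded: "inner_L L \<Gamma> lam \<delta> \<delta> \<le> C_B * K * sqH \<delta>"
  using order_trans[OF inner_L_bounded mult_left_mono[OF inverse, of C_B]] C_B_pos
  by (simp add: mult.assoc)

lemma tested_increment:
  "sqH \<delta> = - dt * (inner_L L \<Gamma> lam u \<delta> - pairH g \<delta>)"
proof -
  have "sqH \<delta> = inner_rho \<Gamma> lam (\<lambda>\<omega>. blinfun_apply \<iota> (\<delta> \<omega>)) (\<lambda>\<omega>. blinfun_apply \<iota> (u' \<omega>))
      - inner_rho \<Gamma> lam (\<lambda>\<omega>. blinfun_apply \<iota> (\<delta> \<omega>)) (\<lambda>\<omega>. blinfun_apply \<iota> (u \<omega>))"
    by (simp add: blinfun.diff_right flip: inner_rho_diff_right)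
  then show ?thesis
    unfolding tested_u tested_u' inner_L_diff_right
    by (simp add: blinfun.diff_right inner_rho_diff_right algebra_simps)
qed

text \<open>Polarization in two forms. Testing with the new value leaves a negative square that
  absorbs errors; testing with the old value leaves a positive square that must itself be
  bounded.\<close>

lemma sqH_increment:
  "sqH u' - sqH u = 2 * inner_rho \<Gamma> lam (\<lambda>\<omega>. blinfun_apply \<iota> (\<delta> \<omega>)) (\<lambda>\<omega>. blinfun_apply \<iota> (u' \<omega>))
     - sqH \<delta>"
  "sqH u' - sqH u = 2 * inner_rho \<Gamma> lam (\<lambda>\<omega>. blinfun_apply \<iota> (\<delta> \<omega>)) (\<lambda>\<omega>. blinfun_apply \<iota> (u \<omega>))
     + sqH \<delta>"
  by (simp_all add: blinfun.diff_right inner_rho_diff_left inner_rho_diff_right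
      inner_rho_commute[of _ _ "\<lambda>\<omega>. blinfun_apply \<iota> (u \<omega>)" "\<lambda>\<omega>. blinfun_apply \<iota> (u' \<omega>)"])

text \<open>The operator acts on \<open>u\<close> but the test function is \<open>u'\<close>, so the
  coercive term at \<open>u'\<close> is corrected by a term in \<delta>. Young's inequality with
  weight \<open>K\<close> splits that term: by the inverse inequality its \<delta> part is at most
  \<open>sqH \<delta>\<close>, cancelled by the negative square from \<open>sqH_increment\<close>,
  and its \<open>u'\<close> part costs \<kappa> units of coercivity.\<close>

lemma energy_H:
  assumes cfl: "dt * K * C_B\<^sup>2 \<le> \<kappa> * C_L"
  shows "sqH u' + dt * C_L * (2 - \<kappa>) * sqV u' \<le> sqH u + 2 * dt * pairH g u'"
proof -
  have "2 * dt * inner_L L \<Gamma> lam \<delta> u'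
      \<le> (\<Sum>\<omega>\<in>\<Gamma>. lam \<omega> * ((norm (\<delta> \<omega>))\<^sup>2 / K + K * (dt * C_B * norm (u' \<omega>))\<^sup>2))"
    unfolding inner_L_def sum_distrib_left
  proof (subst mult.left_commute, intro sum_weighted_mono)
    fix \<omega> assume "\<omega> \<in> \<Gamma>"
    have "2 * dt * blinfun_apply (L \<omega> (\<delta> \<omega>)) (u' \<omega>) \<le> 2 * dt * (C_B * norm (\<delta> \<omega>) * norm (u' \<omega>))"
      using bounded[OF \<open>\<omega> \<in> \<Gamma>\<close>] dt_pos by (intro mult_left_mono) auto
    also have "\<dots> = 2 * norm (\<delta> \<omega>) * (dt * C_B * norm (u' \<omega>))" by simp
    also have "\<dots> \<le> (norm (\<delta> \<omega>))\<^sup>2 / K + K * (dt * C_B * norm (u' \<omega>))\<^sup>2"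
      using K_pos by (rule weighted_AM_GM)
    finally show "2 * dt * blinfun_apply (L \<omega> (\<delta> \<omega>)) (u' \<omega>)
        \<le> (norm (\<delta> \<omega>))\<^sup>2 / K + K * (dt * C_B * norm (u' \<omega>))\<^sup>2" .
  qed
  also have "\<dots> = sqV \<delta> / K + dt * (dt * K * C_B\<^sup>2) * sqV u'"
    by (simp add: inner_rho_def sum.distrib sum_distrib_left sum_divide_distrib distrib_left
        dot_square_norm power_mult_distrib power2_eq_square mult_ac)
  also have "\<dots> \<le> sqH \<delta> + dt * (\<kappa> * C_L) * sqV u'"
    using inverse K_pos dt_pos cfl inner_rho_nonneg[of u']
    by (intro add_mono mult_right_mono mult_left_mono) (auto simp: divide_le_eq mult.commute)
  finally have *: "2 * dt * inner_L L \<Gamma> lam \<delta> u' \<le> sqH \<delta> + dt * (\<kappa> * C_L) * sqV u'" .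
  have split: "inner_L L \<Gamma> lam u u' = inner_L L \<Gamma> lam u' u' - inner_L L \<Gamma> lam \<delta> u'"
    by (simp add: inner_L_diff_left)
  have "sqH u' - sqH u = - 2 * dt * inner_L L \<Gamma> lam u' u' + 2 * dt * inner_L L \<Gamma> lam \<delta> u'
      + 2 * dt * pairH g u' - sqH \<delta>"
    unfolding sqH_increment(1) tested_u' split by (simp add: algebra_simps)
  moreover have "2 * dt * (C_L * sqV u') \<le> 2 * dt * inner_L L \<Gamma> lam u' u'"
    using inner_L_coercive[of u'] dt_pos by simp
  ultimately show ?thesis using * by (simp add: algebra_simps)
qed

text \<open>Symmetry expands the energy difference into the energy of \<delta> plus twice
  \<open>inner_L L \<Gamma> lam u \<delta>\<close>. Testing with \<delta> turns the latter into
  dissipation 2 / dt times \<open>sqH \<delta>\<close>, of which the energy of \<delta> consumes at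
  most the fraction with 2 - \<kappa>.\<close>

lemma energy_L:
  assumes sym: "\<And>\<omega> v w. \<omega> \<in> \<Gamma> \<Longrightarrow> blinfun_apply (L \<omega> v) w = blinfun_apply (L \<omega> w) v"
    and cfl: "dt * K * C_B \<le> 2 - \<kappa>"
  shows "inner_L L \<Gamma> lam u' u' \<le> inner_L L \<Gamma> lam u u + (2 * pairH g \<delta> - \<kappa> / dt * sqH \<delta>)"
proof -
  have "inner_L L \<Gamma> lam u' u = inner_L L \<Gamma> lam u u'"
    unfolding inner_L_def using sym by (intro sum.cong) auto
  then have "inner_L L \<Gamma> lam u' u' - inner_L L \<Gamma> lam u u
      = inner_L L \<Gamma> lam \<delta> \<delta> + 2 * inner_L L \<Gamma> lam u \<delta>"
    by (simp add: inner_L_diff_left inner_L_diff_right)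
  also have "inner_L L \<Gamma> lam u \<delta> = pairH g \<delta> - sqH \<delta> / dt"
    using tested_increment dt_pos by (simp add: field_simps)
  finally have "inner_L L \<Gamma> lam u' u' - inner_L L \<Gamma> lam u u
      = inner_L L \<Gamma> lam \<delta> \<delta> + 2 * pairH g \<delta> - 2 / dt * sqH \<delta>"
    by simp
  moreover have "C_B * K * sqH \<delta> \<le> (2 - \<kappa>) / dt * sqH \<delta>"
    using cfl dt_pos inner_rho_nonneg by (intro mult_right_mono) (auto simp: field_simps)
  ultimately show ?thesis
    using inner_L_increment_bounded by (simp add: diff_divide_distrib left_diff_distrib)
qed

text \<open>Positivity of \<open>inner_L\<close> at \<open>u + u' = 2 u + \<delta>\<close> replaces the Cauchy-Schwarz bound on
  \<open>inner_L u \<delta>\<close> in the energy inner product.\<close>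

lemma contractive_H:
  assumes sym: "\<And>\<omega> v w. \<omega> \<in> \<Gamma> \<Longrightarrow> blinfun_apply (L \<omega> v) w = blinfun_apply (L \<omega> w) v"
    and cfl: "dt * K * C_B \<le> 2"
    and g: "\<And>\<omega>. \<omega> \<in> \<Gamma> \<Longrightarrow> g \<omega> = 0"
  shows "sqH u' \<le> sqH u"
proof -
  have g0: "pairH g v = 0" for v
    using g by (simp add: inner_rho_def)
  have "inner_L L \<Gamma> lam u' u = inner_L L \<Gamma> lam u u'"
    unfolding inner_L_def using sym by (intro sum.cong) auto
  then have "inner_L L \<Gamma> lam (\<lambda>\<omega>. u \<omega> + u' \<omega>) (\<lambda>\<omega>. u \<omega> + u' \<omega>)
      = 4 * inner_L L \<Gamma> lam u u + 4 * inner_L L \<Gamma> lam u \<delta> + inner_L L \<Gamma> lam \<delta> \<delta>"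
    by (simp add: inner_L_diff_left inner_L_diff_right inner_L_add_left inner_L_add_right)
  then have "0 \<le> 4 * inner_L L \<Gamma> lam u u + 4 * inner_L L \<Gamma> lam u \<delta> + inner_L L \<Gamma> lam \<delta> \<delta>"
    using inner_L_nonneg by metis
  also have "\<dots> \<le> 4 * inner_L L \<Gamma> lam u u + 4 * inner_L L \<Gamma> lam u \<delta> + C_B * K * sqH \<delta>"
    using inner_L_increment_bounded by simp
  finally have "0 \<le> dt * (4 * inner_L L \<Gamma> lam u u + 4 * inner_L L \<Gamma> lam u \<delta> + C_B * K * sqH \<delta>)"
    using dt_pos by simp
  also have "\<dots> = 4 * dt * inner_L L \<Gamma> lam u u + (dt * K * C_B - 4) * sqH \<delta>"
    unfolding left_diff_distrib by (subst (3) tested_increment) (simp add: g0 algebra_simps)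
  \<comment> \<open>Halved, the resulting bound says that \<open>sqH \<delta>\<close> is at most 2
    dt times the energy of \<open>u\<close>, which is exactly what the second form of
    \<open>sqH_increment\<close> requires.\<close>
  also have "\<dots> \<le> 4 * dt * inner_L L \<Gamma> lam u u + (- 2) * sqH \<delta>"
    using cfl inner_rho_nonneg by (intro add_left_mono mult_right_mono) auto
  finally show ?thesis
    using sqH_increment(2) unfolding tested_u g0 by simp
qed

end

section \<open>From the DLR scheme to the abstract step, and assembly of the four estimates\<close>

lemma explicit_dlr_solution_step:
  fixes \<iota> :: "'v::real_inner \<Rightarrow>\<^sub>L 'h::real_inner"
  assumes "weighted_sample \<Gamma> lam" and inj: "inj (blinfun_apply \<iota>)" and dt: "dt > 0"
    and Vh: "subspace Vh"
    and solution: "explicit_dlr_solution \<iota> L f \<Gamma> lam Vh R dt N u" and n: "n < N"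
  shows "\<And>\<omega>. \<omega> \<in> \<Gamma> \<Longrightarrow> u (Suc n) \<omega> - u n \<omega> \<in> Vh"
    and "inner_rho \<Gamma> lam (\<lambda>\<omega>. blinfun_apply \<iota> (u (Suc n) \<omega> - u n \<omega>)) (\<lambda>\<omega>. blinfun_apply \<iota> (u n \<omega>))
      = - dt * (inner_L L \<Gamma> lam (u n) (u n)
          - inner_rho \<Gamma> lam (f (real n * dt)) (\<lambda>\<omega>. blinfun_apply \<iota> (u n \<omega>)))"
    and "inner_rho \<Gamma> lam (\<lambda>\<omega>. blinfun_apply \<iota> (u (Suc n) \<omega> - u n \<omega>))
        (\<lambda>\<omega>. blinfun_apply \<iota> (u (Suc n) \<omega>))
      = - dt * (inner_L L \<Gamma> lam (u n) (u (Suc n))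
          - inner_rho \<Gamma> lam (f (real n * dt)) (\<lambda>\<omega>. blinfun_apply \<iota> (u (Suc n) \<omega>)))"
proof -
  interpret weighted_sample \<Gamma> lam by fact
  let ?G = "\<lambda>\<omega>. L \<omega> (u n \<omega>) - H_to_dual \<iota> (f (real n * dt) \<omega>)"
  obtain ub U Y where factors0: "dlr_factors \<Gamma> lam Vh R (ub 0) (U 0) (Y 0)"
    and u: "\<And>m \<omega>. m \<le> N \<Longrightarrow> \<omega> \<in> \<Gamma> \<Longrightarrow> u m \<omega> = dlr_fun R (ub m) (U m) (Y m) \<omega>"
    and step: "\<And>m. m < N \<Longrightarrow> dlr_step \<iota> \<Gamma> lam Vh R dt
                 (\<lambda>\<omega>. L \<omega> (u m \<omega>) - H_to_dual \<iota> (f (real m * dt) \<omega>))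
                 (ub m) (U m) (Y m) (ub (Suc m)) (U (Suc m)) (Y (Suc m))"
    using solution unfolding explicit_dlr_solution_def by blast
  \<comment> \<open>Orthonormality and zero mean are postulated only at time 0; later they are
    supplied by the reorthonormalization that ends the previous step.\<close>
  have factors: "dlr_factors \<Gamma> lam Vh R (ub m) (U m) (Y m)" if "m \<le> N" for m
  proof (cases m)
    case 0
    then show ?thesis using factors0 by simp
  next
    case (Suc k)
    then show ?thesis using step[of k] that unfolding dlr_step_def by auto
  qed
  have u_Vh: "u m \<omega> \<in> Vh" if "m \<le> N" "\<omega> \<in> \<Gamma>" for m \<omega>
    using u[OF that] factors[OF that(1)] Vh unfolding dlr_factors_def dlr_fun_def
    by (auto intro!: subspace_add subspace_sum subspace_scale)
  show "u (Suc n) \<omega> - u n \<omega> \<in> Vh" if "\<omega> \<in> \<Gamma>" for \<omega>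
    using u_Vh[of "Suc n" \<omega>] u_Vh[of n \<omega>] that n Vh by (simp add: subspace_diff)
  have split: "dual_rho \<Gamma> lam ?G v
      = inner_L L \<Gamma> lam (u n) v - inner_rho \<Gamma> lam (f (real n * dt)) (\<lambda>\<omega>. blinfun_apply \<iota> (v \<omega>))" for v
    by (simp add: dual_rho_diff_left dual_rho_H_to_dual inner_L_eq_dual_rho)
  show "inner_rho \<Gamma> lam (\<lambda>\<omega>. blinfun_apply \<iota> (u (Suc n) \<omega> - u n \<omega>)) (\<lambda>\<omega>. blinfun_apply \<iota> (u n \<omega>))
      = - dt * (inner_L L \<Gamma> lam (u n) (u n)
          - inner_rho \<Gamma> lam (f (real n * dt)) (\<lambda>\<omega>. blinfun_apply \<iota> (u n \<omega>)))"
    unfolding split[symmetric]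
    by (rule dlr_step_tested(1)[OF inj dt factors[of n] step[of n]]) (use n u in auto)
  show "inner_rho \<Gamma> lam (\<lambda>\<omega>. blinfun_apply \<iota> (u (Suc n) \<omega> - u n \<omega>))
        (\<lambda>\<omega>. blinfun_apply \<iota> (u (Suc n) \<omega>))
      = - dt * (inner_L L \<Gamma> lam (u n) (u (Suc n))
          - inner_rho \<Gamma> lam (f (real n * dt)) (\<lambda>\<omega>. blinfun_apply \<iota> (u (Suc n) \<omega>)))"
    unfolding split[symmetric]
    by (rule dlr_step_tested(2)[OF inj dt factors[of n] step[of n]]) (use n u in auto)
qed

theorem theorem5p5:
  fixes \<iota> :: "'v::{real_inner,complete_space} \<Rightarrow>\<^sub>L 'h::{real_inner,complete_space}"
    and \<Gamma> :: "'w set" and lam :: "'w \<Rightarrow> real"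
    and L :: "'w \<Rightarrow> 'v \<Rightarrow> ('v \<Rightarrow>\<^sub>L real)"
    and f :: "real \<Rightarrow> 'w \<Rightarrow> 'h"
    and Vh :: "'v set"
    and C_P C_L C_B C_I h T dt :: real
    and R N p :: nat
    and u :: "nat \<Rightarrow> 'w \<Rightarrow> 'v"
  assumes sepV: "separable_space (euclidean :: 'v topology)"
    and sepH: "separable_space (euclidean :: 'h topology)"
    and inj: "inj (blinfun_apply \<iota>)"
    and dense: "closure (range (blinfun_apply \<iota>)) = UNIV"
    and C_P: "C_P > 0" "\<And>v. norm (blinfun_apply \<iota> v) \<le> C_P * norm v"
    and finite_sample: "finite \<Gamma>"
    and weights: "\<And>\<omega>. \<omega> \<in> \<Gamma> \<Longrightarrow> lam \<omega> > 0" "(\<Sum>\<omega>\<in>\<Gamma>. lam \<omega>) = 1"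
    and linear_L: "\<And>\<omega>. \<omega> \<in> \<Gamma> \<Longrightarrow> linear (L \<omega>)"
    and coercive: "C_L > 0"
      "\<And>\<omega> v. \<omega> \<in> \<Gamma> \<Longrightarrow> blinfun_apply (L \<omega> v) v \<ge> C_L * (norm v)\<^sup>2"
    and bounded: "C_B > 0"
      "\<And>\<omega> v w. \<omega> \<in> \<Gamma> \<Longrightarrow> blinfun_apply (L \<omega> v) w \<le> C_B * norm v * norm w"
    and Vh: "subspace Vh" "\<exists>B. finite B \<and> span B = Vh" "R < dim Vh"
    and rank: "R < card \<Gamma>"
    and inverse_ineq: "h > 0" "C_I > 0"
      "\<And>v :: 'w \<Rightarrow> 'v. (\<And>\<omega>. \<omega> \<in> \<Gamma> \<Longrightarrow> v \<omega> \<in> Vh) \<Longrightarrow>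
         norm_rho \<Gamma> lam v \<le> C_I / h ^ p * norm_rho \<Gamma> lam (\<lambda>\<omega>. blinfun_apply \<iota> (v \<omega>))"
    and time: "T > 0" "N > 0" "dt = T / real N"
    and solution: "explicit_dlr_solution \<iota> L f \<Gamma> lam Vh R dt N u"
  shows
    "(\<forall>\<kappa>>0. dt / h ^ (2 * p) \<le> \<kappa> * C_L / (C_I\<^sup>2 * C_B\<^sup>2) \<longrightarrow>
        (norm_rho \<Gamma> lam (\<lambda>\<omega>. blinfun_apply \<iota> (u N \<omega>)))\<^sup>2
          + dt * C_L * (1 - \<kappa>) * (\<Sum>n=0..<N. (norm_rho \<Gamma> lam (u (Suc n)))\<^sup>2)
        \<le> (norm_rho \<Gamma> lam (\<lambda>\<omega>. blinfun_apply \<iota> (u 0 \<omega>)))\<^sup>2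
          + dt * C_P\<^sup>2 / C_L * (\<Sum>n=0..<N. (norm_rho \<Gamma> lam (f (real n * dt)))\<^sup>2))
     \<and> ((\<forall>\<omega>\<in>\<Gamma>. \<forall>v w. blinfun_apply (L \<omega> v) w = blinfun_apply (L \<omega> w) v) \<longrightarrow>
        (\<forall>\<kappa>. 0 < \<kappa> \<and> \<kappa> < 2 \<and> dt / h ^ (2 * p) \<le> (2 - \<kappa>) / (C_I\<^sup>2 * C_B) \<longrightarrow>
          (norm_L L \<Gamma> lam (u N))\<^sup>2
          \<le> (norm_L L \<Gamma> lam (u 0))\<^sup>2
            + dt / \<kappa> * (\<Sum>n=0..<N. (norm_rho \<Gamma> lam (f (real n * dt)))\<^sup>2)))
     \<and> ((\<forall>n<N. \<forall>\<omega>\<in>\<Gamma>. f (real n * dt) \<omega> = 0) \<longrightarrow>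
        (\<forall>n<N. dt / h ^ (2 * p) \<le> 2 * C_L / (C_I\<^sup>2 * C_B\<^sup>2) \<longrightarrow>
          norm_rho \<Gamma> lam (\<lambda>\<omega>. blinfun_apply \<iota> (u (Suc n) \<omega>))
          \<le> norm_rho \<Gamma> lam (\<lambda>\<omega>. blinfun_apply \<iota> (u n \<omega>))))
     \<and> ((\<forall>n<N. \<forall>\<omega>\<in>\<Gamma>. f (real n * dt) \<omega> = 0) \<longrightarrow>
        (\<forall>\<omega>\<in>\<Gamma>. \<forall>v w. blinfun_apply (L \<omega> v) w = blinfun_apply (L \<omega> w) v) \<longrightarrow>
        (\<forall>n<N. dt / h ^ (2 * p) \<le> 2 / (C_I\<^sup>2 * C_B) \<longrightarrow>
          norm_L L \<Gamma> lam (u (Suc n)) \<le> norm_L L \<Gamma> lam (u n) \<and>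
          norm_rho \<Gamma> lam (\<lambda>\<omega>. blinfun_apply \<iota> (u (Suc n) \<omega>))
          \<le> norm_rho \<Gamma> lam (\<lambda>\<omega>. blinfun_apply \<iota> (u n \<omega>))))"
proof -
  interpret weighted_sample \<Gamma> lam
    using finite_sample weights by unfold_locales
  have dt: "dt > 0" using time by simp
  define K where "K = C_I\<^sup>2 / h ^ (2 * p)"
  have K_pos: "K > 0" using inverse_ineq by (simp add: K_def)
  \<comment> \<open>Common form of all the step size conditions: \<open>C\<close> is
    \<open>C_B\<^sup>2\<close> for the H estimates and \<open>C_B\<close> for the symmetric
    ones.\<close>
  have cfl: "dt * K * C \<le> c" if "dt / h ^ (2 * p) \<le> c / (C_I\<^sup>2 * C)" "C > 0" for c C
    using that inverse_ineq(1,2) by (simp add: K_def field_simps)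
  have step: "explicit_galerkin_step \<Gamma> lam \<iota> L (f (real n * dt)) (u n) (u (Suc n)) dt C_L C_B K"
    if n: "n < N" for n
  proof -
    note facts = explicit_dlr_solution_step[OF weighted_sample_axioms inj dt Vh(1) solution n]
    let ?d = "\<lambda>\<omega>. u (Suc n) \<omega> - u n \<omega>"
    have "norm_rho \<Gamma> lam ?d \<le> C_I / h ^ p * norm_rho \<Gamma> lam (\<lambda>\<omega>. blinfun_apply \<iota> (?d \<omega>))"
      by (rule inverse_ineq(3)) (rule facts(1))
    then have "(norm_rho \<Gamma> lam ?d)\<^sup>2
        \<le> (C_I / h ^ p * norm_rho \<Gamma> lam (\<lambda>\<omega>. blinfun_apply \<iota> (?d \<omega>)))\<^sup>2"
      by (rule power_mono) (simp add: norm_rho_def inner_rho_nonneg)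
    then have inverse: "inner_rho \<Gamma> lam ?d ?d
        \<le> K * inner_rho \<Gamma> lam (\<lambda>\<omega>. blinfun_apply \<iota> (?d \<omega>)) (\<lambda>\<omega>. blinfun_apply \<iota> (?d \<omega>))"
      by (simp add: K_def norm_rho_power2 power_mult_distrib power_divide power_even_eq)
    show ?thesis
      by (rule explicit_galerkin_step.intro[OF weighted_sample_axioms],
          rule explicit_galerkin_step_axioms.intro)
        (fact dt K_pos coercive bounded linear_L facts(2,3) inverse)+
  qed
  \<comment> \<open>Young's weight \<open>C_L\<close> makes the forcing cost exactly one of the 2 -
    \<kappa> units left by \<open>energy_H\<close>.\<close>
  have forcing_V: "2 * dt * inner_rho \<Gamma> lam g (\<lambda>\<omega>. blinfun_apply \<iota> (v \<omega>))
      \<le> dt * C_P\<^sup>2 / C_L * inner_rho \<Gamma> lam g g + dt * C_L * inner_rho \<Gamma> lam v v" for g v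
  proof -
    have "2 * dt * inner_rho \<Gamma> lam g (\<lambda>\<omega>. blinfun_apply \<iota> (v \<omega>))
        \<le> (\<Sum>\<omega>\<in>\<Gamma>. lam \<omega> * (dt * ((C_P * norm (g \<omega>))\<^sup>2 / C_L + C_L * (norm (v \<omega>))\<^sup>2)))"
      unfolding inner_rho_def sum_distrib_left
    proof (subst mult.left_commute, intro sum_weighted_mono)
      fix \<omega> assume "\<omega> \<in> \<Gamma>"
      have "inner (g \<omega>) (blinfun_apply \<iota> (v \<omega>)) \<le> norm (g \<omega>) * (C_P * norm (v \<omega>))"
        by (rule order_trans[OF norm_cauchy_schwarz mult_left_mono]) (simp_all add: C_P)
      then have "2 * inner (g \<omega>) (blinfun_apply \<iota> (v \<omega>)) \<le> 2 * (C_P * norm (g \<omega>)) * norm (v \<omega>)"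
        by (simp add: mult_ac)
      also have "\<dots> \<le> (C_P * norm (g \<omega>))\<^sup>2 / C_L + C_L * (norm (v \<omega>))\<^sup>2"
        using coercive(1) by (rule weighted_AM_GM)
      finally show "2 * dt * inner (g \<omega>) (blinfun_apply \<iota> (v \<omega>))
          \<le> dt * ((C_P * norm (g \<omega>))\<^sup>2 / C_L + C_L * (norm (v \<omega>))\<^sup>2)"
        using dt by simp
    qed
    also have "\<dots> = dt * C_P\<^sup>2 / C_L * inner_rho \<Gamma> lam g g + dt * C_L * inner_rho \<Gamma> lam v v"
      by (simp add: inner_rho_def sum.distrib sum_distrib_left distrib_left
          dot_square_norm power_mult_distrib power2_eq_square mult_ac)
    finally show ?thesis .
  qed
  \<comment> \<open>The weight \<kappa> / dt is the dissipation left over by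
    \<open>energy_L\<close>.\<close>
  have forcing_H: "2 * inner_rho \<Gamma> lam g w - \<kappa> / dt * inner_rho \<Gamma> lam w w
      \<le> dt / \<kappa> * inner_rho \<Gamma> lam g g" if "\<kappa> > 0" for \<kappa> and g w :: "'w \<Rightarrow> 'h"
  proof -
    have "2 * inner_rho \<Gamma> lam g w
        \<le> (\<Sum>\<omega>\<in>\<Gamma>. lam \<omega> * ((norm (g \<omega>))\<^sup>2 / (\<kappa> / dt) + \<kappa> / dt * (norm (w \<omega>))\<^sup>2))"
      unfolding inner_rho_def sum_distrib_left
    proof (subst mult.left_commute, intro sum_weighted_mono)
      fix \<omega>
      have "2 * inner (g \<omega>) (w \<omega>) \<le> 2 * norm (g \<omega>) * norm (w \<omega>)"
        using norm_cauchy_schwarz[of "g \<omega>" "w \<omega>"] by simp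
      also have "\<dots> \<le> (norm (g \<omega>))\<^sup>2 / (\<kappa> / dt) + \<kappa> / dt * (norm (w \<omega>))\<^sup>2"
        using that dt by (intro weighted_AM_GM) simp
      finally show "2 * inner (g \<omega>) (w \<omega>)
          \<le> (norm (g \<omega>))\<^sup>2 / (\<kappa> / dt) + \<kappa> / dt * (norm (w \<omega>))\<^sup>2" .
    qed
    also have "\<dots> = dt / \<kappa> * inner_rho \<Gamma> lam g g + \<kappa> / dt * inner_rho \<Gamma> lam w w"
      by (simp add: inner_rho_def sum.distrib sum_distrib_left distrib_left
          dot_square_norm mult_ac)
    finally show ?thesis by simp
  qed
  \<comment> \<open>Nonnegativity of the energy is available inside a step, so step 0 is
    instantiated; it exists because \<open>N\<close> is positive.\<close>
  have norm_L_power2: "(norm_L L \<Gamma> lam v)\<^sup>2 = inner_L L \<Gamma> lam v v" for v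
    using explicit_galerkin_step.inner_L_nonneg[OF step[OF time(2)]] by (simp add: norm_L_def)
  show ?thesis
  proof (intro conjI allI impI; (elim conjE)?)
    fix \<kappa> :: real
    assume "\<kappa> > 0" and c: "dt / h ^ (2 * p) \<le> \<kappa> * C_L / (C_I\<^sup>2 * C_B\<^sup>2)"
    show "(norm_rho \<Gamma> lam (\<lambda>\<omega>. blinfun_apply \<iota> (u N \<omega>)))\<^sup>2
          + dt * C_L * (1 - \<kappa>) * (\<Sum>n=0..<N. (norm_rho \<Gamma> lam (u (Suc n)))\<^sup>2)
        \<le> (norm_rho \<Gamma> lam (\<lambda>\<omega>. blinfun_apply \<iota> (u 0 \<omega>)))\<^sup>2
          + dt * C_P\<^sup>2 / C_L * (\<Sum>n=0..<N. (norm_rho \<Gamma> lam (f (real n * dt)))\<^sup>2)"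
      unfolding sum_distrib_left norm_rho_power2
    proof (rule sum_telescope_le)
      fix n assume n: "n < N"
      interpret S: explicit_galerkin_step \<Gamma> lam \<iota> L "f (real n * dt)" "u n" "u (Suc n)" dt C_L C_B K
        using n by (rule step)
      show "S.sqH (u (Suc n)) + dt * C_L * (1 - \<kappa>) * S.sqV (u (Suc n))
          \<le> S.sqH (u n) + dt * C_P\<^sup>2 / C_L * inner_rho \<Gamma> lam (f (real n * dt)) (f (real n * dt))"
        using S.energy_H[OF cfl[OF c]] forcing_V[of "f (real n * dt)" "u (Suc n)"] bounded(1)
        by (simp add: algebra_simps)
    qed
  next
    fix \<kappa> :: real
    assume sym: "\<forall>\<omega>\<in>\<Gamma>. \<forall>v w. blinfun_apply (L \<omega> v) w = blinfun_apply (L \<omega> w) v"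
      and \<kappa>: "0 < \<kappa>" and c: "dt / h ^ (2 * p) \<le> (2 - \<kappa>) / (C_I\<^sup>2 * C_B)"
    \<comment> \<open>The zero sum casts the estimate in the form of
      \<open>sum_telescope_le\<close>, since no dissipation is retained on the left.\<close>
    have "inner_L L \<Gamma> lam (u N) (u N) + (\<Sum>n=0..<N. 0) \<le> inner_L L \<Gamma> lam (u 0) (u 0)
        + (\<Sum>n=0..<N. dt / \<kappa> * inner_rho \<Gamma> lam (f (real n * dt)) (f (real n * dt)))"
    proof (rule sum_telescope_le)
      fix n assume n: "n < N"
      interpret S: explicit_galerkin_step \<Gamma> lam \<iota> L "f (real n * dt)" "u n" "u (Suc n)" dt C_L C_B K
        using n by (rule step)
      show "inner_L L \<Gamma> lam (u (Suc n)) (u (Suc n)) + 0 \<le> inner_L L \<Gamma> lam (u n) (u n)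
          + dt / \<kappa> * inner_rho \<Gamma> lam (f (real n * dt)) (f (real n * dt))"
        using S.energy_L[OF _ cfl[OF c bounded(1)]] sym
          forcing_H[OF \<kappa>, of "f (real n * dt)" "\<lambda>\<omega>. blinfun_apply \<iota> (S.\<delta> \<omega>)"]
        by fastforce
    qed
    then show "(norm_L L \<Gamma> lam (u N))\<^sup>2 \<le> (norm_L L \<Gamma> lam (u 0))\<^sup>2
            + dt / \<kappa> * (\<Sum>n=0..<N. (norm_rho \<Gamma> lam (f (real n * dt)))\<^sup>2)"
      by (simp add: norm_L_power2 norm_rho_power2 sum_distrib_left)
  next
    fix n assume f0: "\<forall>n<N. \<forall>\<omega>\<in>\<Gamma>. f (real n * dt) \<omega> = 0" and n: "n < N"
      and c: "dt / h ^ (2 * p) \<le> 2 * C_L / (C_I\<^sup>2 * C_B\<^sup>2)"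
    interpret S: explicit_galerkin_step \<Gamma> lam \<iota> L "f (real n * dt)" "u n" "u (Suc n)" dt C_L C_B K
      using n by (rule step)
    have "S.pairH (f (real n * dt)) (u (Suc n)) = 0"
      using f0 n by (simp add: inner_rho_def)
    \<comment> \<open>The condition is the case \<kappa> = 2 of \<open>energy_H\<close>: the whole
      coercivity is spent on the explicit evaluation and the V term disappears.\<close>
    then show "norm_rho \<Gamma> lam (\<lambda>\<omega>. blinfun_apply \<iota> (u (Suc n) \<omega>))
        \<le> norm_rho \<Gamma> lam (\<lambda>\<omega>. blinfun_apply \<iota> (u n \<omega>))"
      using S.energy_H[OF cfl[OF c]] bounded(1) by (simp add: norm_rho_def)
  next
    fix n assume f0: "\<forall>n<N. \<forall>\<omega>\<in>\<Gamma>. f (real n * dt) \<omega> = 0" and n: "n < N"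
      and sym: "\<forall>\<omega>\<in>\<Gamma>. \<forall>v w. blinfun_apply (L \<omega> v) w = blinfun_apply (L \<omega> w) v"
      and c: "dt / h ^ (2 * p) \<le> 2 / (C_I\<^sup>2 * C_B)"
    interpret S: explicit_galerkin_step \<Gamma> lam \<iota> L "f (real n * dt)" "u n" "u (Suc n)" dt C_L C_B K
      using n by (rule step)
    have "S.pairH (f (real n * dt)) S.\<delta> = 0"
      using f0 n by (simp add: inner_rho_def)
    \<comment> \<open>The case \<kappa> = 0 of \<open>energy_L\<close>: with no forcing, no
      dissipation has to be held back.\<close>
    then show "norm_L L \<Gamma> lam (u (Suc n)) \<le> norm_L L \<Gamma> lam (u n)"
      using S.energy_L[of 0] sym cfl[OF c bounded(1)] by (simp add: norm_L_def)
    show "norm_rho \<Gamma> lam (\<lambda>\<omega>. blinfun_apply \<iota> (u (Suc n) \<omega>))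
        \<le> norm_rho \<Gamma> lam (\<lambda>\<omega>. blinfun_apply \<iota> (u n \<omega>))"
      using S.contractive_H[OF _ cfl[OF c bounded(1)]] sym f0 n by (simp add: norm_rho_def)
  qed
qed

end
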